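(* Let $(Q_1,Q_2)\sim \mathrm{DMMT}(\boldsymbol{\rho},\boldsymbol{\alpha},\boldsymbol{\lambda},Q_0)$ and assume: (1) the initial state probability satisfies $\rho_{0,s}<1$; (2) the transition probabilities $\rho_{d,d}(A),\rho_{d,m}(A),\rho_{d,s}(A),\rho_{m,m}(A),\rho_{m,s}(A)$, the direction probabilities $\lambda_j(A,g)$, and the pseudo-count ratios $\alpha^j_{t,l}(A,g)/\big(\alpha^j_{t,l}(A,g)+\alpha^j_{t,r}(A,g)\big)$ are uniformly bounded away from $0$ and $1$, over all $A\in\mathcal{A}^{(\infty)}$ and $g\in\{d,m\}$ (and all $j=1,\dots,p$, $t=1,2$). Then, for any pair of probability distributions $F_1,F_2$ on $\Omega$ absolutely continuous with respect to $Q_0$ and any $\tau>0$, $$\Pr\Big(\int |\tilde q_t-\tilde f_t|\,dQ_0<\tau\ \text{ for } t=1,2\Big)>0,$$ where $\tilde q_t=dQ_t/dQ_0$ and $\tilde f_t=dF_t/dQ_0$.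
   Context: **Partitions.** $\Omega=[0,1)^p$. For a rectangle $A=\prod_{i=1}^p[a_i,b_i)$ and $j\in\{1,\dots,p\}$, $A^j_l$ is the half of $A$ whose $j$th coordinate lies in $[a_j,(a_j+b_j)/2)$ and $A^j_r$ the half whose $j$th coordinate lies in $[(a_j+b_j)/2,b_j)$. $\mathcal{A}^k$ is the set of all subsets obtainable from $\Omega$ by $k$ successive splits of this kind ($\mathcal{A}^0=\{\Omega\}$), $\mathcal{A}^{(k)}=\cup_{i=0}^k\mathcal{A}^i$, $\mathcal{A}^{(\infty)}=\cup_{i\ge0}\mathcal{A}^i$. **DMMT.** Let $\mathcal{G}=\{d,m,s\}$ ("divide", "merge", "stop"). The parameters are: a baseline probability measure $Q_0$ on $\Omega$; initial state probabilities $(\rho_{0,d},\rho_{0,m},\rho_{0,s})$ (nonnegative, summing to 1); for each $A\in\mathcal{A}^{(\infty)}$, transition probabilities $\rho_{h,g}(A)\ge0$ ($h,g\in\mathcal{G}$) with $\sum_g\rho_{h,g}(A)=1$, $\rho_{s,d}(A)=\rho_{s,m}(A)=0$, $\rho_{s,s}(A)=1$ (all these together form $\boldsymbol{\rho}$); direction probabilities $\lambda_j(A,g)\ge0$, $g\in\{d,m\}$, $\sum_{j=1}^p\lambda_j(A,g)=1$ (forming $\boldsymbol{\lambda}$); positive pseudo-counts $\boldsymbol{\alpha}^j_t(A,d)=(\alpha^j_{t,l}(A,d),\alpha^j_{t,r}(A,d))$, $t=1,2$, and $\boldsymbol{\alpha}^j(A,m)=(\alpha^j_l(A,m),\alpha^j_r(A,m))$,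 with the convention $\alpha^j_{t,i}(A,m)=\alpha^j_i(A,m)$ for $t=1,2$ (forming $\boldsymbol{\alpha}$). The random pair $(Q_1,Q_2)$ is generated by starting at $A=\Omega$ with $Q_1(\Omega)=Q_2(\Omega)=1$, the state $S(\mathrm{parent}(\Omega))$ of the fictitious parent of $\Omega$ being drawn from $(\rho_{0,d},\rho_{0,m},\rho_{0,s})$, and recursively doing the following (all draws independent given the previous ones) on each node $A$ reached: (i) draw the state $S(A)\in\mathcal{G}$ with $\Pr[S(A)=g\mid S(\mathrm{parent}(A))=h]=\rho_{h,g}(A)$; (ii) if $S(A)=s$, set $Q_1(\cdot|A)=Q_2(\cdot|A)=Q_0(\cdot|A)$ and stop on $A$; if $S(A)=g\in\{d,m\}$, draw a direction $J(A)=j$ with probability $\lambda_j(A,g)$ and split $A$ into $A^j_l,A^j_r$; (iii) if $S(A)=d$, draw independent $Y_t(A)\sim\mathrm{Beta}(\boldsymbol{\alpha}^j_t(A,d))$, $t=1,2$; if $S(A)=m$, draw $Y_1(A)=Y_2(A)\sim\mathrm{Beta}(\boldsymbol{\alpha}^j(A,m))$; set $Q_t(A^j_l)=Q_t(A)Y_t(A)$, $Q_t(A^j_r)=Q_t(A)(1-Y_t(A))$, and apply (i)–(iii) to $A^j_l$ and $A^j_r$. If there is $\delta>0$ with $\rho_{g,s}(A)>\delta$ for all $A\in\mathcal{A}^{(\infty)}$, $g\in\mathcal{G}$, then with probability 1 the procedure stops almost everywhere on $\Omega$ and yields a well-defined pair of probability measures absolutely continuous with respect to $Q_0$; the law of this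 pair is denoted $\mathrm{DMMT}(\boldsymbol{\rho},\boldsymbol{\alpha},\boldsymbol{\lambda},Q_0)$.
   Formalization: Added: ρ_{0,d}>0 or ρ_{m,d}(Ω)>0; without it (e.g. ρ_{0,m}=1, ρ_{m,d}≡0) state d is never reached, Q1=Q2 a.s., and the claim fails for F1≠F2. Also Q0(A)>0 for every A in 𝒜^(∞), so that Q0(·|A) is defined. *)

theory Defs
  imports "HOL-Probability.Probability"
begin

(* A half-open rectangle is represented by its pair of corner vectors (a, b); on the
   nonempty rectangles used below this pair and the set determine each other. *)
type_synonym 'p rect = "(real ^ 'p) \<times> (real ^ 'p)"

definition rect_set :: "'p::finite rect \<Rightarrow> (real ^ 'p) set" where
  "rect_set A = {x. \<forall>i. fst A $ i \<le> x $ i \<and> x $ i < snd A $ i}"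

definition midpt :: "'p::finite \<Rightarrow> 'p rect \<Rightarrow> real" where
  "midpt j A = (fst A $ j + snd A $ j) / 2"

definition left_half :: "'p::finite \<Rightarrow> 'p rect \<Rightarrow> 'p rect" where
  "left_half j A = (fst A, \<chi> i. if i = j then midpt j A else snd A $ i)"

definition right_half :: "'p::finite \<Rightarrow> 'p rect \<Rightarrow> 'p rect" where
  "right_half j A = (\<chi> i. if i = j then midpt j A else fst A $ i, snd A)"

definition unit_rect :: "'p::finite rect" where
  "unit_rect = (\<chi> i. 0, \<chi> i. 1)"

primrec level_nodes :: "nat \<Rightarrow> 'p::finite rect set" where
  "level_nodes 0 = {unit_rect}"
| "level_nodes (Suc k) = (\<Union>A\<in>level_nodes k. \<Union>j. {left_half j A, right_half j A})"

definition nodes :: "'p::finite rect set" where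
  "nodes = (\<Union>k. level_nodes k)"

definition cube_borel :: "(real ^ 'p::finite) measure" where
  "cube_borel = restrict_space borel (rect_set unit_rect)"

datatype gstate = Divide | Merge | Stop

definition beta_measure :: "real \<times> real \<Rightarrow> real measure" where
  "beta_measure ab = density lborel
     (\<lambda>y. ennreal (indicator {0<..<1} y * y powr (fst ab - 1) * (1 - y) powr (snd ab - 1)
                   / Beta (fst ab) (snd ab)))"

(* Parameters of the process:
     \<rho>0            law of the state of the fictitious parent of the root,
     \<rho> A h         law of the state of A given the parent's state h,
     \<alpha> A g j t     pseudo-counts (left, right) for sample t (1 or 2), state g, direction j,
     \<Lambda> A g         law of the split direction of A in state g.
   The values of \<alpha> and \<Lambda> at g = Stop are never used. *)

(* The randomness: for every node, one independent draw for each situation in which the node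
   may be visited, namely its state for each parent's state h, its direction for each g, and
   its beta proportions for each (g, j, t).  A run of the procedure visits a node at most once
   and then uses only the draws for the current situation, so the draws used have the
   conditional laws of the sequential description. *)
type_synonym 'p draws =
  "gstate \<times> ('p rect \<times> gstate \<Rightarrow> gstate) \<times> ('p rect \<times> gstate \<Rightarrow> 'p) \<times>
   ('p rect \<times> gstate \<times> 'p \<times> nat \<Rightarrow> real)"

definition dmmt_draws ::
  "gstate pmf \<Rightarrow> ('p::finite rect \<Rightarrow> gstate \<Rightarrow> gstate pmf) \<Rightarrow>
   ('p rect \<Rightarrow> gstate \<Rightarrow> 'p \<Rightarrow> nat \<Rightarrow> real \<times> real) \<Rightarrow> ('p rect \<Rightarrow> gstate \<Rightarrow> 'p pmf) \<Rightarrow>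
   'p draws measure" where
  "dmmt_draws \<rho>0 \<rho> \<alpha> \<Lambda> =
     measure_pmf \<rho>0 \<Otimes>\<^sub>M
     (\<Pi>\<^sub>M (A, h) \<in> nodes \<times> UNIV. measure_pmf (\<rho> A h)) \<Otimes>\<^sub>M
     (\<Pi>\<^sub>M (A, g) \<in> nodes \<times> {Divide, Merge}. measure_pmf (\<Lambda> A g)) \<Otimes>\<^sub>M
     (\<Pi>\<^sub>M (A, g, j, t) \<in> nodes \<times> {Divide, Merge} \<times> UNIV \<times> {1, 2}. beta_measure (\<alpha> A g j t))"

(* run_mass Q0 t S J Y n A h q B is the Q_t-mass of B carried by those nodes below A at which
   the procedure stops within n generations, when A is reached with parent's state h and
   Q_t(A) = q.  In the merge state both samples use the same beta draw (the one stored at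
   t = 1). *)
primrec run_mass ::
  "(real ^ 'p::finite) measure \<Rightarrow> nat \<Rightarrow> ('p rect \<times> gstate \<Rightarrow> gstate) \<Rightarrow>
   ('p rect \<times> gstate \<Rightarrow> 'p) \<Rightarrow> ('p rect \<times> gstate \<times> 'p \<times> nat \<Rightarrow> real) \<Rightarrow>
   nat \<Rightarrow> 'p rect \<Rightarrow> gstate \<Rightarrow> real \<Rightarrow> (real ^ 'p) set \<Rightarrow> ennreal" where
  "run_mass Q0 t S J Y 0 A h q B = 0"
| "run_mass Q0 t S J Y (Suc n) A h q B =
     (let g = S (A, h) in
      if g = Stop then ennreal q * emeasure (uniform_measure Q0 (rect_set A)) B
      else let j = J (A, g); y = Y (A, g, j, if g = Merge then 1 else t) in
        run_mass Q0 t S J Y n (left_half j A) g (q * y) B +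
        run_mass Q0 t S J Y n (right_half j A) g (q * (1 - y)) B)"

definition dmmt_measure ::
  "(real ^ 'p::finite) measure \<Rightarrow> nat \<Rightarrow> 'p draws \<Rightarrow> (real ^ 'p) measure" where
  "dmmt_measure Q0 t = (\<lambda>(h0, S, J, Y).
     measure_of (space cube_borel) (sets cube_borel)
       (\<lambda>B. SUP n. run_mass Q0 t S J Y n unit_rect h0 1 B))"

(* The law of the random pair.  The two measures are probability measures only almost surely
   (when the stopping probabilities are bounded below); on the exceptional null set both are
   set to Q0, so that the pair takes values in the space of pairs of probability measures. *)
definition DMMT ::
  "gstate pmf \<Rightarrow> ('p::finite rect \<Rightarrow> gstate \<Rightarrow> gstate pmf) \<Rightarrow>
   ('p rect \<Rightarrow> gstate \<Rightarrow> 'p \<Rightarrow> nat \<Rightarrow> real \<times> real) \<Rightarrow> ('p rect \<Rightarrow> gstate \<Rightarrow> 'p pmf) \<Rightarrow>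
   (real ^ 'p) measure \<Rightarrow> ((real ^ 'p) measure \<times> (real ^ 'p) measure) measure" where
  "DMMT \<rho>0 \<rho> \<alpha> \<Lambda> Q0 =
     distr (dmmt_draws \<rho>0 \<rho> \<alpha> \<Lambda>) (prob_algebra cube_borel \<Otimes>\<^sub>M prob_algebra cube_borel)
       (\<lambda>\<omega>. if prob_space (dmmt_measure Q0 1 \<omega>) \<and> prob_space (dmmt_measure Q0 2 \<omega>)
            then (dmmt_measure Q0 1 \<omega>, dmmt_measure Q0 2 \<omega>) else (Q0, Q0))"

definition unif_away_01 :: "real set \<Rightarrow> bool" where
  "unif_away_01 X \<longleftrightarrow> (\<exists>\<epsilon>>0. \<forall>x\<in>X. \<epsilon> \<le> x \<and> x \<le> 1 - \<epsilon>)"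

(* Real-valued version of dQ/dQ0; to be used only when Q is absolutely continuous. *)
definition rn_dens :: "'a measure \<Rightarrow> 'a measure \<Rightarrow> 'a \<Rightarrow> real" where
  "rn_dens Q0 Q x = enn2real (RN_deriv Q0 Q x)"

end

(* Fix a direction sequence e in which every coordinate recurs, so that splitting along e yields
   dyadic cells that shrink to points and generate the Borel sets.  For F << Q0, replacing F on each
   level-K cell by its mean with respect to Q0 gives measures converging to F in total variation.
   With positive probability the process divides every node of level < K along e, stops at level K,
   and draws all beta proportions within delta of F_t(left half) / F_t(cell): this constrains
   finitely many independent draws, each by an event of positive probability.  On that event Q_t is
   a level-K mixture within O(K delta) of the averaged F_t.  Measurability of the limiting event holds
   because both absolute continuity and L1 distance are determined by the values of a measure on a
   countable family of sets. *)
theory Submission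
  imports Defs
begin

section \<open>Dyadic cells\<close>

text \<open>Convergence of the cell averages is proved without martingale theory. The averaging
  error is linear in the density, vanishes for the indicator of a cell once the partition is at
  least as fine, and is bounded by twice the L1 norm uniformly in depth and test set. So the
  densities with uniformly small error are closed under dominated limits, and a pi-lambda argument
  starting from the cells reaches every integrable density. Uniformity in the test set matters
  because the L1 distance of two probability densities is twice the largest difference of the two
  measures on a set. The depth has to be fixed before delta: an error below delta in each proportion
  costs up to 2 delta of mass per generation. Only state Divide can steer the samples to different
  targets, since Merge shares one proportion. Below the root every parent is then in state Divide,
  so apart from the root's own state only draws indexed by a node and Divide are constrained.
  Absolute continuity quantifies over uncountably many sets, while the sigma-algebra on measures is
  generated by evaluations at single sets; hence the passage to a countable family.\<close>

definition rect_vol :: "'p::finite rect \<Rightarrow> real" where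
  "rect_vol A = (\<Prod>i\<in>UNIV. snd A $ i - fst A $ i)"

lemma left_half_sel [simp]:
  "fst (left_half j A) $ i = fst A $ i"
  "snd (left_half j A) $ i = (if i = j then midpt j A else snd A $ i)"
  by (simp_all add: left_half_def)

lemma right_half_sel [simp]:
  "fst (right_half j A) $ i = (if i = j then midpt j A else fst A $ i)"
  "snd (right_half j A) $ i = snd A $ i"
  by (simp_all add: right_half_def)

lemma mem_rect_set: "x \<in> rect_set A \<longleftrightarrow> (\<forall>i. fst A $ i \<le> x $ i \<and> x $ i < snd A $ i)"
  by (simp add: rect_set_def)

lemma level_nodes_nondegenerate: "A \<in> level_nodes n \<Longrightarrow> fst A $ i < snd A $ i"
proof (induction n arbitrary: A)
  case 0
  then show ?case by (simp add: unit_rect_def)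
next
  case (Suc n)
  then obtain B j where B: "B \<in> level_nodes n" "A = left_half j B \<or> A = right_half j B"
    by auto
  from Suc.IH[OF B(1)] have "fst B $ i < snd B $ i" .
  with B(2) show ?case by (auto simp: midpt_def)
qed

lemma level_nodes_vol: "A \<in> level_nodes n \<Longrightarrow> rect_vol A = 1 / 2 ^ n"
proof (induction n arbitrary: A)
  case 0
  then show ?case by (simp add: unit_rect_def rect_vol_def)
next
  case (Suc n)
  then obtain B j where B: "B \<in> level_nodes n" "A = left_half j B \<or> A = right_half j B"
    by auto
  have "snd A $ i - fst A $ i = (if i = j then 1/2 else 1) * (snd B $ i - fst B $ i)" for i
    using B(2) by (auto simp: midpt_def field_simps)
  then have "rect_vol A = (\<Prod>i\<in>UNIV. if i = j then 1/2 else 1) * rect_vol B"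
    unfolding rect_vol_def by (simp only: prod.distrib)
  then show ?case using Suc.IH[OF B(1)] by simp
qed

text \<open>Different orders of splits can lead to the same rectangle, so its level cannot be read
  off a derivation. The volume, halved by every split, determines it; this makes a direction that
  depends only on the level a function of the node.\<close>

lemma level_nodes_unique: "A \<in> level_nodes m \<Longrightarrow> A \<in> level_nodes n \<Longrightarrow> m = n"
proof -
  assume "A \<in> level_nodes m" "A \<in> level_nodes n"
  then have "(1::real) / 2 ^ m = 1 / 2 ^ n" using level_nodes_vol by metis
  then have "(2::real) ^ m = 2 ^ n" by (metis inverse_eq_divide inverse_inverse_eq)
  then show "m = n" by simp
qed

definition node_level :: "'p::finite rect \<Rightarrow> nat" where
  "node_level A = (THE n. A \<in> level_nodes n)"

lemma node_level_eq: "A \<in> level_nodes n \<Longrightarrow> node_level A = n"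
  unfolding node_level_def by (rule the_equality) (auto dest: level_nodes_unique)

lemma finite_level_nodes: "finite (level_nodes n)"
  by (induction n) auto

lemma countable_nodes: "countable nodes"
  unfolding nodes_def by (simp add: countable_finite finite_level_nodes)

lemma level_nodes_subset_nodes: "level_nodes n \<subseteq> nodes"
  by (auto simp: nodes_def)

lemma unit_rect_node: "unit_rect \<in> nodes"
  unfolding nodes_def by (rule UN_I[of 0]) auto

lemma half_level_nodes:
  assumes "A \<in> level_nodes n"
  shows "left_half j A \<in> level_nodes (Suc n)" "right_half j A \<in> level_nodes (Suc n)"
  using assms by auto

lemma half_nodes:
  assumes "A \<in> nodes"
  shows "left_half j A \<in> nodes" "right_half j A \<in> nodes"
proof -
  obtain n where "A \<in> level_nodes n" using assms by (auto simp: nodes_def)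
  from half_level_nodes[OF this, of j] level_nodes_subset_nodes
  show "left_half j A \<in> nodes" "right_half j A \<in> nodes" by blast+
qed

lemma rect_set_halves:
  assumes "A \<in> nodes"
  shows "rect_set A = rect_set (left_half j A) \<union> rect_set (right_half j A)"
proof -
  have "fst A $ i < snd A $ i" for i
    using assms level_nodes_nondegenerate unfolding nodes_def by blast
  then have "fst A $ j \<le> midpt j A" "midpt j A \<le> snd A $ j"
    by (simp_all add: midpt_def field_simps less_imp_le)
  then show ?thesis
    unfolding set_eq_iff Un_iff mem_rect_set left_half_sel right_half_sel
    by (smt (verit))
qed

lemma rect_set_halves_disjoint:
  "rect_set (left_half j A) \<inter> rect_set (right_half j A) = {}"
  unfolding disjoint_iff mem_rect_set left_half_sel right_half_sel
  by (metis not_le)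

lemma rect_set_subset_unit:
  assumes "A \<in> nodes"
  shows "rect_set A \<subseteq> rect_set unit_rect"
proof -
  obtain n where "A \<in> level_nodes n" using assms by (auto simp: nodes_def)
  then show ?thesis
  proof (induction n arbitrary: A)
    case (Suc n)
    then obtain B j where B: "B \<in> level_nodes n" "A = left_half j B \<or> A = right_half j B"
      by auto
    then have "rect_set A \<subseteq> rect_set B"
      using rect_set_halves[of B j] level_nodes_subset_nodes by blast
    then show ?case using Suc.IH[OF B(1)] by blast
  qed simp
qed

lemma sets_borel_rect_set [measurable]: "rect_set A \<in> sets borel"
proof -
  have "rect_set A = (\<Inter>i. {x. fst A $ i \<le> x $ i} \<inter> {x. x $ i < snd A $ i})"
    by (auto simp: rect_set_def)
  also have "\<dots> \<in> sets borel"
    by (intro sets.finite_INT sets.Int borel_closed borel_open)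
       (auto intro!: closed_Collect_le open_Collect_less continuous_intros)
  finally show ?thesis .
qed

lemma space_cube_borel [simp]: "space cube_borel = rect_set unit_rect"
  by (simp add: cube_borel_def space_restrict_space)

lemma sets_cube_borel_iff: "B \<in> sets cube_borel \<longleftrightarrow> B \<in> sets borel \<and> B \<subseteq> rect_set unit_rect"
  unfolding cube_borel_def by (subst sets_restrict_space_iff) auto

lemma sets_cube_borel_node: "A \<in> nodes \<Longrightarrow> rect_set A \<in> sets cube_borel"
  unfolding sets_cube_borel_iff using rect_set_subset_unit sets_borel_rect_set by blast

section \<open>Partitions with one split direction per generation\<close>

primrec cells :: "(nat \<Rightarrow> 'p::finite) \<Rightarrow> nat \<Rightarrow> 'p rect set" where
  "cells e 0 = {unit_rect}"
| "cells e (Suc n) = (\<Union>A\<in>cells e n. {left_half (e n) A, right_half (e n) A})"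

lemma cells_subset_level_nodes: "cells e n \<subseteq> level_nodes n"
  by (induction n) auto

lemma cells_nodes: "A \<in> cells e n \<Longrightarrow> A \<in> nodes"
  using cells_subset_level_nodes level_nodes_subset_nodes by blast

lemma half_cells:
  assumes "A \<in> cells e n"
  shows "left_half (e n) A \<in> cells e (Suc n)" "right_half (e n) A \<in> cells e (Suc n)"
  using assms by auto

lemma cells_cover: "x \<in> rect_set unit_rect \<Longrightarrow> \<exists>A\<in>cells e n. x \<in> rect_set A"
proof (induction n)
  case (Suc n)
  then obtain A where A: "A \<in> cells e n" "x \<in> rect_set A" by blast
  then have "x \<in> rect_set (left_half (e n) A) \<or> x \<in> rect_set (right_half (e n) A)"
    using rect_set_halves[OF cells_nodes[OF A(1)], of "e n"] by blast
  then show ?case using half_cells[OF A(1)] by blast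
qed simp

lemma cells_disjoint:
  assumes "A \<in> cells e n" "C \<in> cells e n" "A \<noteq> C"
  shows "rect_set A \<inter> rect_set C = {}"
  using assms
proof (induction n arbitrary: A C)
  case (Suc n)
  obtain A' where A': "A' \<in> cells e n" "A = left_half (e n) A' \<or> A = right_half (e n) A'"
    using Suc.prems(1) by auto
  obtain C' where C': "C' \<in> cells e n" "C = left_half (e n) C' \<or> C = right_half (e n) C'"
    using Suc.prems(2) by auto
  have "rect_set A \<subseteq> rect_set A'" "rect_set C \<subseteq> rect_set C'"
    using rect_set_halves[OF cells_nodes[OF A'(1)], of "e n"] A'(2)
      rect_set_halves[OF cells_nodes[OF C'(1)], of "e n"] C'(2) by blast+
  then show ?case
    using Suc.IH[OF A'(1) C'(1)] A'(2) C'(2) Suc.prems(3) rect_set_halves_disjoint[of "e n" C']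
    by (cases "A' = C'") auto
qed simp

text \<open>Halves stay inside their cell, so refining from level \<open>n\<close> to level
  \<open>m\<close> never makes a cell straddle the boundary of \<open>C\<close>.\<close>

lemma cells_nested:
  assumes "A \<in> cells e m" "C \<in> cells e n" "n \<le> m"
  shows "rect_set A \<subseteq> rect_set C \<or> rect_set A \<inter> rect_set C = {}"
  using assms(3,1)
proof (induction m arbitrary: A rule: dec_induct)
  case base
  then show ?case using cells_disjoint[OF _ assms(2)] by blast
next
  case (step m)
  then obtain A' where A': "A' \<in> cells e m" "A = left_half (e m) A' \<or> A = right_half (e m) A'"
    by auto
  have "rect_set A \<subseteq> rect_set A'"
    using rect_set_halves[OF cells_nodes[OF A'(1)], of "e m"] A'(2) by blast
  then show ?case using step.IH[OF A'(1)] by blast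
qed

definition recurrent :: "(nat \<Rightarrow> 'a) \<Rightarrow> bool" where
  "recurrent e \<longleftrightarrow> (\<forall>i n. \<exists>k\<ge>n. e k = i)"

text \<open>Read \<open>k\<close> as the code of a pair and take its first component: the value
  \<open>i\<close> is hit at the code of \<open>(i, n)\<close>, which is at least
  \<open>n\<close>.\<close>

lemma recurrent_exists: "\<exists>e :: nat \<Rightarrow> 'a::countable. recurrent e"
  unfolding recurrent_def
  apply (rule exI[of _ "\<lambda>k. from_nat (fst (prod_decode k)) :: 'a"])
  apply (rule allI)+
  subgoal for i n
    by (rule exI[of _ "prod_encode (to_nat i, n)"]) (simp add: le_prod_encode_2)
  done

lemma cells_side_antimono:
  assumes "m \<le> n" "\<And>C. C \<in> cells e m \<Longrightarrow> snd C $ i - fst C $ i \<le> r" "A \<in> cells e n"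
  shows "snd A $ i - fst A $ i \<le> r"
  using assms(1,3)
proof (induction n arbitrary: A rule: dec_induct)
  case base
  then show ?case using assms(2) by blast
next
  case (step n)
  then obtain B where B: "B \<in> cells e n" "A = left_half (e n) B \<or> A = right_half (e n) B"
    by auto
  have "fst B $ i < snd B $ i"
    using B(1) cells_subset_level_nodes level_nodes_nondegenerate by blast
  then have "snd A $ i - fst A $ i \<le> snd B $ i - fst B $ i"
    using B(2) by (auto simp: midpt_def)
  then show ?case using step.IH[OF B(1)] by linarith
qed

text \<open>Each further occurrence of \<open>i\<close> in \<open>e\<close> halves side
  \<open>i\<close> once more, and the splits in between do not lengthen it.\<close>

lemma cells_side_small:
  assumes "recurrent e"
  shows "\<exists>n. \<forall>A\<in>cells e n. snd A $ i - fst A $ i \<le> 1 / 2 ^ m"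
proof (induction m)
  case 0
  show ?case by (rule exI[of _ 0]) (simp add: unit_rect_def)
next
  case (Suc m)
  then obtain n where n: "\<And>A. A \<in> cells e n \<Longrightarrow> snd A $ i - fst A $ i \<le> 1 / 2 ^ m" by blast
  obtain k where k: "n \<le> k" "e k = i" using assms by (auto simp: recurrent_def)
  have "snd A $ i - fst A $ i \<le> 1 / 2 ^ Suc m" if A: "A \<in> cells e (Suc k)" for A
  proof -
    obtain B where B: "B \<in> cells e k" "A = left_half i B \<or> A = right_half i B"
      using A k(2) by auto
    have "snd B $ i - fst B $ i \<le> 1 / 2 ^ m" using cells_side_antimono[OF k(1) n B(1)] .
    with B(2) show ?thesis by (auto simp: midpt_def field_simps)
  qed
  then show ?case by blast
qed

lemma cells_small:
  assumes "recurrent e" "0 < r"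
  shows "\<exists>n. \<forall>A\<in>cells e n. \<forall>x\<in>rect_set A. \<forall>y\<in>rect_set A. dist x y < r"
proof -
  have c: "0 < real CARD('a)" by simp
  \<comment> \<open>The Euclidean distance is bounded by the sum of the coordinate distances, so the
    sides must be below \<open>r\<close> divided by the dimension.\<close>
  obtain m where m: "(1/2) ^ m < r / real CARD('a)"
    using real_arch_pow_inv[of "r / real CARD('a)" "1/2"] divide_pos_pos[OF assms(2) c] by auto
  have "\<forall>i. \<exists>n. \<forall>A\<in>cells e n. snd A $ i - fst A $ i \<le> 1 / 2 ^ m"
    using cells_side_small[OF assms(1)] by blast
  from choice[OF this]
  obtain N where N: "\<And>i A. A \<in> cells e (N i) \<Longrightarrow> snd A $ i - fst A $ i \<le> 1 / 2 ^ m"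
    by blast
  define n where "n = Max (range N)"
  have "dist x y < r" if A: "A \<in> cells e n" and xy: "x \<in> rect_set A" "y \<in> rect_set A" for A x y
  proof -
    have side: "snd A $ i - fst A $ i \<le> 1 / 2 ^ m" for i
      using cells_side_antimono[of "N i" n e i, OF _ N A] by (auto simp: n_def)
    have "\<bar>(x - y) $ i\<bar> \<le> 1 / 2 ^ m" for i
      using xy side[of i] unfolding mem_rect_set
      by (auto dest!: spec[of _ i])
    then have "(\<Sum>i\<in>UNIV. \<bar>(x - y) $ i\<bar>) \<le> (\<Sum>i\<in>(UNIV::'a set). 1 / 2 ^ m)"
      by (rule sum_mono)
    then have "norm (x - y) \<le> (\<Sum>i\<in>(UNIV::'a set). 1 / 2 ^ m)"
      using norm_le_l1_cart[of "x - y"] by linarith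
    also have "\<dots> < r" using m c by (simp add: field_simps)
    finally show ?thesis by (simp add: dist_norm)
  qed
  then show ?thesis by blast
qed

text \<open>Cells shrink to points, so the trace of an open set on the cube is the union of the
  cells inside the open set, and there are only countably many nodes.\<close>

lemma sets_cube_borel_cells:
  fixes e :: "nat \<Rightarrow> 'p::finite"
  assumes "recurrent e"
  shows "sets cube_borel = sigma_sets (rect_set unit_rect) (insert {} (\<Union>n. rect_set ` cells e n))"
    (is "_ = sigma_sets ?U ?G")
proof
  have "?G \<subseteq> sets cube_borel"
    using cells_nodes sets_cube_borel_node by blast
  then show "sigma_sets ?U ?G \<subseteq> sets cube_borel"
    by (metis sets.sigma_sets_subset space_cube_borel)
next
  have "?G \<subseteq> Pow ?U"
    using cells_nodes rect_set_subset_unit by blast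
  then interpret G: sigma_algebra ?U "sigma_sets ?U ?G"
    by (rule sigma_algebra_sigma_sets)
  have open_case: "V \<inter> ?U \<in> sigma_sets ?U ?G" if V: "open V" for V
  proof -
    define X where "X = {A \<in> nodes. (\<exists>n. A \<in> cells e n) \<and> rect_set A \<subseteq> V}"
    have "V \<inter> ?U = (\<Union>A\<in>X. rect_set A)"
    proof (intro equalityI subsetI)
      fix x assume x: "x \<in> V \<inter> ?U"
      then obtain r where r: "0 < r" "ball x r \<subseteq> V"
        using V open_contains_ball by blast
      obtain n where n: "\<forall>A\<in>cells e n. \<forall>x\<in>rect_set A. \<forall>y\<in>rect_set A. dist x y < r"
        using cells_small[OF assms r(1)] by blast
      obtain A where A: "A \<in> cells e n" "x \<in> rect_set A" using cells_cover x by blast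
      have "rect_set A \<subseteq> V" using n A r(2) by (auto simp: subset_iff)
      then show "x \<in> (\<Union>A\<in>X. rect_set A)" using A cells_nodes[OF A(1)] unfolding X_def by blast
    next
      fix x assume "x \<in> (\<Union>A\<in>X. rect_set A)"
      then show "x \<in> V \<inter> ?U" using rect_set_subset_unit by (auto simp: X_def)
    qed
    moreover have "countable X" by (rule countable_subset[OF _ countable_nodes]) (auto simp: X_def)
    moreover have "rect_set A \<in> sigma_sets ?U ?G" if "A \<in> X" for A
      using that by (intro sigma_sets.Basic) (auto simp: X_def)
    ultimately show ?thesis by (auto intro!: G.countable_UN'')
  qed
  show "sets cube_borel \<subseteq> sigma_sets ?U ?G"
  proof
    fix B :: "(real ^ 'p) set" assume "B \<in> sets cube_borel"
    then have B: "B \<in> sigma_sets UNIV (Collect open)" "B \<subseteq> ?U"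
      by (auto simp: sets_cube_borel_iff borel_def)
    \<comment> \<open>The induction runs over Borel sets of the whole space and carries their traces
      on the cube; complements then turn into complements relative to the cube.\<close>
    from B(1) have "B \<inter> ?U \<in> sigma_sets ?U ?G"
    proof induction
      case (Basic a)
      then show ?case using open_case by simp
    next
      case (Compl a)
      have "(UNIV - a) \<inter> ?U = ?U - a \<inter> ?U" by blast
      then show ?case using G.compl_sets[OF Compl.IH] by (simp only:)
    next
      case (Union a)
      have "\<Union> (range a) \<inter> ?U = (\<Union>i. a i \<inter> ?U)" by blast
      moreover have "(\<Union>i. a i \<inter> ?U) \<in> sigma_sets ?U ?G"
        by (rule G.countable_UN) (use Union.IH in blast)
      ultimately show ?case by simp
    qed simp
    with B(2) show "B \<in> sigma_sets ?U ?G" by (simp add: Int_absorb2)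
  qed
qed

text \<open>Two cells are nested or disjoint; the empty set is added to the generator for the
  disjoint case.\<close>

lemma Int_stable_cells: "Int_stable (insert {} (\<Union>n. rect_set ` cells e n))"
proof (rule Int_stableI)
  fix a b assume a: "a \<in> insert {} (\<Union>n. rect_set ` cells e n)"
    and b: "b \<in> insert {} (\<Union>n. rect_set ` cells e n)"
  show "a \<inter> b \<in> insert {} (\<Union>n. rect_set ` cells e n)"
  proof (cases "a = {} \<or> b = {}")
    case False
    then obtain m n A C where AC: "A \<in> cells e m" "C \<in> cells e n" "a = rect_set A" "b = rect_set C"
      using a b by blast
    consider "a \<subseteq> b" | "b \<subseteq> a" | "a \<inter> b = {}"
      using cells_nested[OF AC(1,2)] cells_nested[OF AC(2,1)] AC(3,4)
      by (metis inf_commute nat_le_linear)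
    then show ?thesis
    proof cases
      case 1
      then have "a \<inter> b = a" by blast
      with a show ?thesis by (simp only:)
    next
      case 2
      then have "a \<inter> b = b" by blast
      with b show ?thesis by (simp only:)
    qed simp
  qed auto
qed

section \<open>Densities and total variation\<close>

lemma rn_dens_nonneg: "0 \<le> rn_dens Q0 Q x"
  by (simp add: rn_dens_def)

lemma borel_measurable_rn_dens [measurable]: "rn_dens Q0 Q \<in> borel_measurable Q0"
  unfolding rn_dens_def[abs_def] by measurable

text \<open>\<open>Q\<close> is finite, so its Radon-Nikodym derivative is finite almost everywhere
  and the conversion to reals changes it only on a null set.\<close>

lemma density_rn_dens:
  assumes "prob_space Q0" "prob_space Q" "sets Q = sets Q0" "absolutely_continuous Q0 Q"
  shows "density Q0 (\<lambda>x. ennreal (rn_dens Q0 Q x)) = Q"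
proof -
  interpret Q0: prob_space Q0 by fact
  interpret Q: prob_space Q by fact
  have "AE x in Q0. RN_deriv Q0 Q x \<noteq> \<infinity>"
    using assms by (intro Q0.RN_deriv_finite Q.sigma_finite_measure_axioms)
  then have "AE x in Q0. ennreal (rn_dens Q0 Q x) = RN_deriv Q0 Q x"
    by eventually_elim (simp add: rn_dens_def less_top)
  then have "density Q0 (\<lambda>x. ennreal (rn_dens Q0 Q x)) = density Q0 (RN_deriv Q0 Q)"
    by (intro density_cong) auto
  then show ?thesis using Q0.density_RN_deriv[OF assms(4,3)] by simp
qed

lemma integrable_rn_dens:
  assumes "prob_space Q0" "prob_space Q" "sets Q = sets Q0" "absolutely_continuous Q0 Q"
  shows "integrable Q0 (rn_dens Q0 Q)"
proof -
  interpret Q: prob_space Q by fact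
  have "integrable (density Q0 (\<lambda>x. ennreal (rn_dens Q0 Q x))) (\<lambda>x. 1 :: real)"
    unfolding density_rn_dens[OF assms] by simp
  then show ?thesis
    by (subst (asm) integrable_density) (auto simp: rn_dens_nonneg)
qed

lemma measure_eq_rn_dens:
  assumes "prob_space Q0" "prob_space Q" "sets Q = sets Q0" "absolutely_continuous Q0 Q"
    and B: "B \<in> sets Q0"
  shows "measure Q B = (LINT x:B|Q0. rn_dens Q0 Q x)"
proof -
  have "measure Q B = (\<integral>x. indicator B x \<partial>Q)"
    using B assms(3) sets.sets_into_space by (simp add: Int_absorb2)
  also have "\<dots> = (\<integral>x. indicator B x \<partial>density Q0 (\<lambda>x. ennreal (rn_dens Q0 Q x)))"
    by (simp only: density_rn_dens[OF assms(1-4)])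
  also have "\<dots> = (LINT x:B|Q0. rn_dens Q0 Q x)"
    using B by (subst integral_density) (auto simp: rn_dens_nonneg set_lebesgue_integral_def mult.commute)
  finally show ?thesis .
qed

text \<open>Scheffe's identity. The difference of two probability densities integrates to 0, so its
  positive and negative parts have equal mass; the set where the difference is positive attains the
  supremum.\<close>

lemma rn_dens_L1_eq:
  assumes Q0: "prob_space Q0"
    and Q: "prob_space Q" "sets Q = sets Q0" "absolutely_continuous Q0 Q"
    and F: "prob_space F" "sets F = sets Q0" "absolutely_continuous Q0 F"
  shows "\<exists>B\<in>sets Q0. (\<integral>x. \<bar>rn_dens Q0 Q x - rn_dens Q0 F x\<bar> \<partial>Q0) = 2 * (measure Q B - measure F B)"
    and "C \<in> sets Q0 \<Longrightarrow> 2 * (measure Q C - measure F C) \<le> (\<integral>x. \<bar>rn_dens Q0 Q x - rn_dens Q0 F x\<bar> \<partial>Q0)"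
proof -
  interpret Q0: prob_space Q0 by fact
  define d where "d = (\<lambda>x. rn_dens Q0 Q x - rn_dens Q0 F x)"
  have int: "integrable Q0 d"
    unfolding d_def by (intro Bochner_Integration.integrable_diff integrable_rn_dens assms)
  then have intB: "set_integrable Q0 B d" if "B \<in> sets Q0" for B
    unfolding set_integrable_def using that by (intro integrable_mult_indicator)
  have intB': "set_integrable Q0 B (rn_dens Q0 Q)" "set_integrable Q0 B (rn_dens Q0 F)"
    if "B \<in> sets Q0" for B
    unfolding set_integrable_def
    by (rule integrable_mult_indicator[OF that integrable_rn_dens[OF Q0 Q]],
        rule integrable_mult_indicator[OF that integrable_rn_dens[OF Q0 F]])
  have diff: "measure Q B - measure F B = (LINT x:B|Q0. d x)" if "B \<in> sets Q0" for B
    unfolding measure_eq_rn_dens[OF Q0 Q that] measure_eq_rn_dens[OF Q0 F that] d_def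
    by (intro set_integral_diff(2)[symmetric] intB' that)
  have total: "(LINT x:space Q0|Q0. d x) = 0"
    using diff[of "space Q0"] prob_space.prob_space[OF Q(1)] prob_space.prob_space[OF F(1)]
      sets_eq_imp_space_eq[OF Q(2)] sets_eq_imp_space_eq[OF F(2)] by simp
  \<comment> \<open>The weight is 1 on \<open>B\<close> and -1 off \<open>B\<close>: this gives at
    most the L1 norm for every \<open>B\<close>, and exactly the L1 norm when \<open>B\<close> is
    the set where \<open>d\<close> is positive.\<close>
  have key: "2 * (measure Q B - measure F B) = (\<integral>x. (indicator B x - indicator (space Q0 - B) x) * d x \<partial>Q0)"
    if B: "B \<in> sets Q0" for B
  proof -
    have "(LINT x:space Q0|Q0. d x) = (LINT x:B|Q0. d x) + (LINT x:space Q0 - B|Q0. d x)"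
      using B sets.sets_into_space[OF B]
      by (subst set_integral_Un[symmetric]) (auto intro!: intB simp: Un_absorb1)
    then have "2 * (LINT x:B|Q0. d x) = (LINT x:B|Q0. d x) - (LINT x:space Q0 - B|Q0. d x)"
      using total by simp
    also have "\<dots> = (\<integral>x. indicator B x *\<^sub>R d x - indicator (space Q0 - B) x *\<^sub>R d x \<partial>Q0)"
      using intB[OF B] intB[OF sets.compl_sets[OF B]]
      unfolding set_lebesgue_integral_def set_integrable_def by simp
    finally show ?thesis using diff[OF B] by (simp add: algebra_simps)
  qed
  have int_key: "integrable Q0 (\<lambda>x. (indicator B x - indicator (space Q0 - B) x) * d x)"
    if B: "B \<in> sets Q0" for B
    using Bochner_Integration.integrable_diff[OF
        intB[OF B, unfolded set_integrable_def]
        intB[OF sets.compl_sets[OF B], unfolded set_integrable_def]]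
    by (simp add: algebra_simps)
  show "2 * (measure Q C - measure F C) \<le> (\<integral>x. \<bar>rn_dens Q0 Q x - rn_dens Q0 F x\<bar> \<partial>Q0)" if C: "C \<in> sets Q0"
    unfolding key[OF C] d_def[symmetric]
  proof (rule integral_mono[OF int_key[OF C]])
    show "integrable Q0 (\<lambda>x. \<bar>rn_dens Q0 Q x - rn_dens Q0 F x\<bar>)"
      using integrable_abs[OF int] by (simp add: d_def)
    show "(indicator C x - indicator (space Q0 - C) x) * d x \<le> \<bar>rn_dens Q0 Q x - rn_dens Q0 F x\<bar>" for x
      by (auto simp: d_def split: split_indicator)
  qed
  have m: "{x \<in> space Q0. 0 < d x} \<in> sets Q0"
    unfolding d_def by measurable
  have "(\<integral>x. \<bar>d x\<bar> \<partial>Q0) = 2 * (measure Q {x \<in> space Q0. 0 < d x} - measure F {x \<in> space Q0. 0 < d x})"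
    unfolding key[OF m] by (intro Bochner_Integration.integral_cong) (auto split: split_indicator)
  then show "\<exists>B\<in>sets Q0. (\<integral>x. \<bar>rn_dens Q0 Q x - rn_dens Q0 F x\<bar> \<partial>Q0) = 2 * (measure Q B - measure F B)"
    using m unfolding d_def by blast
qed

section \<open>Averaging over cells\<close>

locale dyadic_base = prob_space Q0 for Q0 :: "(real ^ 'p::finite) measure" +
  fixes e :: "nat \<Rightarrow> 'p"
  assumes sets_Q0: "sets Q0 = sets cube_borel"
    and node_pos: "\<And>A. A \<in> nodes \<Longrightarrow> 0 < measure Q0 (rect_set A)"
    and recurrent: "recurrent e"
begin

lemma space_Q0: "space Q0 = rect_set unit_rect"
  using sets_eq_imp_space_eq[OF sets_Q0] by simp

lemma node_measurable: "A \<in> nodes \<Longrightarrow> rect_set A \<in> sets Q0"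
  by (simp add: sets_Q0 sets_cube_borel_node)

text \<open>Here \<open>k\<close> is the generation of \<open>A\<close> and \<open>n\<close> the
  number of splits still to be made. When \<open>w\<close> is the mass under \<open>F\<close>,
  starting at the root gives the measure whose density is the conditional expectation of
  \<open>dF/dQ0\<close> given the level-\<open>n\<close> cells. The recursion follows the shape of
  \<open>run_mass\<close>, so that one induction can compare the two.\<close>

primrec averaged :: "('p rect \<Rightarrow> real) \<Rightarrow> nat \<Rightarrow> nat \<Rightarrow> 'p rect \<Rightarrow> (real ^ 'p) set \<Rightarrow> real" where
  "averaged w 0 k A B = w A * (measure Q0 (rect_set A \<inter> B) / measure Q0 (rect_set A))"
| "averaged w (Suc n) k A B =
     averaged w n (Suc k) (left_half (e k) A) B + averaged w n (Suc k) (right_half (e k) A) B"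

text \<open>Signed, and for arbitrary real \<open>f\<close> instead of a probability density, so
  that it is linear in \<open>f\<close>.\<close>

definition avg_err :: "(real ^ 'p \<Rightarrow> real) \<Rightarrow> nat \<Rightarrow> nat \<Rightarrow> 'p rect \<Rightarrow> (real ^ 'p) set \<Rightarrow> real" where
  "avg_err f n k A B = averaged (\<lambda>A. LINT x:rect_set A|Q0. f x) n k A B
     - (LINT x:(rect_set A \<inter> B)|Q0. f x)"

lemma averaged_add: "averaged (\<lambda>A. v A + w A) n k A B = averaged v n k A B + averaged w n k A B"
  by (induction n arbitrary: k A) (simp_all add: algebra_simps add_divide_distrib)

lemma averaged_cmult: "averaged (\<lambda>A. c * w A) n k A B = c * averaged w n k A B"
  by (induction n arbitrary: k A) (simp_all add: algebra_simps)

lemma averaged_cong: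
  assumes "\<And>A. A \<in> nodes \<Longrightarrow> v A = w A" "A \<in> nodes"
  shows "averaged v n k A B = averaged w n k A B"
  using assms(2) by (induction n arbitrary: k A) (simp_all add: assms(1) half_nodes)

lemma set_integrable_Q0:
  fixes f :: "real ^ 'p \<Rightarrow> real"
  assumes "integrable Q0 f" "B \<in> sets Q0"
  shows "set_integrable Q0 B f"
  unfolding set_integrable_def using assms by (intro integrable_mult_indicator)

lemma avg_err_add:
  assumes "integrable Q0 f" "integrable Q0 g" "A \<in> nodes" "B \<in> sets Q0"
  shows "avg_err (\<lambda>x. f x + g x) n k A B = avg_err f n k A B + avg_err g n k A B"
proof -
  have add: "(LINT x:C|Q0. f x + g x) = (LINT x:C|Q0. f x) + (LINT x:C|Q0. g x)" if "C \<in> sets Q0" for C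
    using that assms(1,2) by (intro set_integral_add(2) set_integrable_Q0)
  have "averaged (\<lambda>A. LINT x:rect_set A|Q0. f x + g x) n k A B =
      averaged (\<lambda>A. (LINT x:rect_set A|Q0. f x) + (LINT x:rect_set A|Q0. g x)) n k A B"
    by (rule averaged_cong[OF _ assms(3)]) (rule add[OF node_measurable])
  then show ?thesis
    using add[of "rect_set A \<inter> B"] node_measurable[OF assms(3)] assms(4)
    unfolding avg_err_def averaged_add by simp
qed

lemma avg_err_cmult: "avg_err (\<lambda>x. c * f x) n k A B = c * avg_err f n k A B"
  unfolding avg_err_def by (simp add: averaged_cmult algebra_simps)

lemma avg_err_Suc:
  assumes "integrable Q0 f" "A \<in> nodes" "B \<in> sets Q0"
  shows "avg_err f (Suc n) k A B =
    avg_err f n (Suc k) (left_half (e k) A) B + avg_err f n (Suc k) (right_half (e k) A) B"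
proof -
  let ?L = "rect_set (left_half (e k) A)" and ?R = "rect_set (right_half (e k) A)"
  have m: "?L \<in> sets Q0" "?R \<in> sets Q0"
    using node_measurable half_nodes[OF assms(2)] by blast+
  have "rect_set A \<inter> B = (?L \<inter> B) \<union> (?R \<inter> B)" "(?L \<inter> B) \<inter> (?R \<inter> B) = {}"
    using rect_set_halves[OF assms(2), of "e k"] rect_set_halves_disjoint[of "e k" A] by auto
  then have "(LINT x:(rect_set A \<inter> B)|Q0. f x) = (LINT x:(?L \<inter> B)|Q0. f x) + (LINT x:(?R \<inter> B)|Q0. f x)"
    using m assms(1,3) by (simp only:) (intro set_integral_Un set_integrable_Q0 sets.Int)
  then show ?thesis by (simp add: avg_err_def)
qed

text \<open>Averaging spreads the mass of each cell without increasing its absolute value, so each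
  of the two terms is at most the integral of the absolute value of \<open>f\<close>. The bound
  depends neither on \<open>n\<close> nor on \<open>B\<close>, which is what makes limits in
  \<open>f\<close> possible.\<close>

lemma abs_avg_err_le:
  assumes f: "integrable Q0 f" and "A \<in> nodes" and B: "B \<in> sets Q0"
  shows "\<bar>avg_err f n k A B\<bar> \<le> 2 * (LINT x:rect_set A|Q0. \<bar>f x\<bar>)"
  using assms(2)
proof (induction n arbitrary: k A)
  case 0
  note m = node_measurable[OF 0]
  have p: "0 \<le> measure Q0 (rect_set A \<inter> B) / measure Q0 (rect_set A)"
      "measure Q0 (rect_set A \<inter> B) / measure Q0 (rect_set A) \<le> 1"
    using node_pos[OF 0] m B by (auto simp: divide_le_eq intro!: finite_measure_mono)
  have abs_le: "\<bar>LINT x:C|Q0. f x\<bar> \<le> (LINT x:rect_set A|Q0. \<bar>f x\<bar>)"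
    if C: "C \<in> sets Q0" "C \<subseteq> rect_set A" for C
  proof -
    have "\<bar>LINT x:C|Q0. f x\<bar> \<le> (\<integral>x. norm (indicator C x *\<^sub>R f x) \<partial>Q0)"
      unfolding set_lebesgue_integral_def real_norm_def[symmetric] by (rule integral_norm_bound)
    also have "\<dots> \<le> (\<integral>x. indicator (rect_set A) x *\<^sub>R \<bar>f x\<bar> \<partial>Q0)"
      using C(2) by (intro integral_mono integrable_norm integrable_mult_indicator integrable_abs f m C(1))
        (auto split: split_indicator)
    also have "\<dots> = (LINT x:rect_set A|Q0. \<bar>f x\<bar>)"
      by (simp add: set_lebesgue_integral_def)
    finally show ?thesis .
  qed
  have "\<bar>(LINT x:rect_set A|Q0. f x) * (measure Q0 (rect_set A \<inter> B) / measure Q0 (rect_set A))\<bar>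
      \<le> \<bar>LINT x:rect_set A|Q0. f x\<bar>"
    unfolding abs_mult abs_of_nonneg[OF p(1)] by (rule mult_left_le[OF p(2) abs_ge_zero])
  then show ?case
    using abs_le[of "rect_set A"] abs_le[of "rect_set A \<inter> B"] m B
    unfolding avg_err_def averaged.simps by (smt (verit) sets.Int inf_le1 order_refl)
next
  case (Suc n)
  let ?L = "rect_set (left_half (e k) A)" and ?R = "rect_set (right_half (e k) A)"
  have m: "?L \<in> sets Q0" "?R \<in> sets Q0"
    using node_measurable half_nodes[OF Suc.prems] by blast+
  have "(LINT x:rect_set A|Q0. \<bar>f x\<bar>) = (LINT x:?L|Q0. \<bar>f x\<bar>) + (LINT x:?R|Q0. \<bar>f x\<bar>)"
    unfolding rect_set_halves[OF Suc.prems, of "e k"]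
    by (intro set_integral_Un set_integrable_Q0 integrable_abs f m rect_set_halves_disjoint)
  then show ?case
    using Suc.IH[OF half_nodes(1)[OF Suc.prems], of "Suc k" "e k"]
      Suc.IH[OF half_nodes(2)[OF Suc.prems], of "Suc k" "e k"]
    unfolding avg_err_Suc[OF f Suc.prems B] by linarith
qed

text \<open>When the leaves, of generation \<open>k + n\<close>, are at least as fine as
  \<open>C\<close>, each of them lies inside \<open>C\<close> or misses it, so the indicator is
  constant on every leaf and averaging reproduces it.\<close>

lemma avg_err_cell:
  assumes C: "C \<in> cells e c" and "A \<in> cells e k" "c \<le> k + n" and B: "B \<in> sets Q0"
  shows "avg_err (indicator (rect_set C)) n k A B = 0"
  using assms(2,3)
proof (induction n arbitrary: k A)
  case 0
  note A = cells_nodes[OF 0(1)] and mC = node_measurable[OF cells_nodes[OF C]]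
  have int: "(LINT x:D|Q0. indicator (rect_set C) x) = measure Q0 (D \<inter> rect_set C)"
    if "D \<in> sets Q0" for D
    unfolding set_lebesgue_integral_def
    using that mC by (simp add: indicator_inter_arith[symmetric])
  have err: "avg_err (indicator (rect_set C)) 0 k A B =
      measure Q0 (rect_set A \<inter> rect_set C) * (measure Q0 (rect_set A \<inter> B) / measure Q0 (rect_set A))
      - measure Q0 (rect_set A \<inter> B \<inter> rect_set C)"
    unfolding avg_err_def averaged.simps
    using int[OF node_measurable[OF A]] int[OF sets.Int[OF node_measurable[OF A] B]] by simp
  consider "rect_set A \<subseteq> rect_set C" | "rect_set A \<inter> rect_set C = {}"
    using cells_nested[OF 0(1) C] 0(2) by auto
  then show ?case
  proof cases
    case 1
    then have "rect_set A \<inter> rect_set C = rect_set A" "rect_set A \<inter> B \<inter> rect_set C = rect_set A \<inter> B"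
      by auto
    then show ?thesis
      using node_pos[OF A] by (simp add: err)
  next
    case 2
    then have "rect_set A \<inter> rect_set C = {}" "rect_set A \<inter> B \<inter> rect_set C = {}"
      by auto
    then show ?thesis
      by (simp add: err)
  qed
next
  case (Suc n)
  have "integrable Q0 (indicator (rect_set C) :: _ \<Rightarrow> real)"
    using node_measurable[OF cells_nodes[OF C]] by (simp add: less_top[symmetric])
  then show ?case
    using Suc.IH[OF half_cells(1)[OF Suc.prems(1)]] Suc.IH[OF half_cells(2)[OF Suc.prems(1)]] Suc.prems(2)
    by (simp add: avg_err_Suc[OF _ cells_nodes[OF Suc.prems(1)] B])
qed

section \<open>Densities approximated by their cell averages uniformly over test sets\<close>

definition avg_approx :: "(real ^ 'p \<Rightarrow> real) \<Rightarrow> bool" where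
  "avg_approx f \<longleftrightarrow> (\<forall>\<eta>>0. \<exists>N. \<forall>n\<ge>N. \<forall>B\<in>sets Q0. \<bar>avg_err f n 0 unit_rect B\<bar> \<le> \<eta>)"

lemma avg_approx_add:
  assumes "integrable Q0 f" "integrable Q0 g" "avg_approx f" "avg_approx g"
  shows "avg_approx (\<lambda>x. f x + g x)"
  unfolding avg_approx_def
proof (intro allI impI)
  fix \<eta> :: real assume "0 < \<eta>"
  then have "0 < \<eta> / 2" by simp
  then obtain N1 N2
    where N1: "\<And>n B. n \<ge> N1 \<Longrightarrow> B \<in> sets Q0 \<Longrightarrow> \<bar>avg_err f n 0 unit_rect B\<bar> \<le> \<eta> / 2"
      and N2: "\<And>n B. n \<ge> N2 \<Longrightarrow> B \<in> sets Q0 \<Longrightarrow> \<bar>avg_err g n 0 unit_rect B\<bar> \<le> \<eta> / 2"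
    using assms(3,4) unfolding avg_approx_def by meson
  have "\<bar>avg_err (\<lambda>x. f x + g x) n 0 unit_rect B\<bar> \<le> \<eta>"
    if "n \<ge> max N1 N2" "B \<in> sets Q0" for n B
    using N1[of n B] N2[of n B] that avg_err_add[OF assms(1,2) unit_rect_node that(2), of n 0] by auto
  then show "\<exists>N. \<forall>n\<ge>N. \<forall>B\<in>sets Q0. \<bar>avg_err (\<lambda>x. f x + g x) n 0 unit_rect B\<bar> \<le> \<eta>" by blast
qed

lemma avg_approx_cmult:
  assumes "avg_approx f"
  shows "avg_approx (\<lambda>x. c * f x)"
  unfolding avg_approx_def
proof (intro allI impI)
  fix \<eta> :: real assume \<eta>: "0 < \<eta>"
  \<comment> \<open>The added 1 covers \<open>c = 0\<close>.\<close>
  then have "0 < \<eta> / (1 + \<bar>c\<bar>)" by (intro divide_pos_pos) auto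
  then obtain N where
    N: "\<And>n B. n \<ge> N \<Longrightarrow> B \<in> sets Q0 \<Longrightarrow> \<bar>avg_err f n 0 unit_rect B\<bar> \<le> \<eta> / (1 + \<bar>c\<bar>)"
    using assms unfolding avg_approx_def by meson
  have "\<bar>avg_err (\<lambda>x. c * f x) n 0 unit_rect B\<bar> \<le> \<eta>" if "n \<ge> N" "B \<in> sets Q0" for n B
  proof -
    have "\<bar>avg_err (\<lambda>x. c * f x) n 0 unit_rect B\<bar> = \<bar>c\<bar> * \<bar>avg_err f n 0 unit_rect B\<bar>"
      by (simp add: avg_err_cmult abs_mult)
    also have "\<dots> \<le> (1 + \<bar>c\<bar>) * (\<eta> / (1 + \<bar>c\<bar>))"
      using N[OF that] by (intro mult_mono) auto
    also have "\<dots> = \<eta>" by simp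
    finally show ?thesis .
  qed
  then show "\<exists>N. \<forall>n\<ge>N. \<forall>B\<in>sets Q0. \<bar>avg_err (\<lambda>x. c * f x) n 0 unit_rect B\<bar> \<le> \<eta>" by blast
qed

text \<open>The hypotheses have the form of the limit case of \<open>integrable_induct\<close>.
  Dominated convergence makes some \<open>s i\<close> close to \<open>f\<close> in L1, and
  \<open>abs_avg_err_le\<close> controls the remainder at all depths at once.\<close>

lemma avg_approx_lim:
  assumes s: "\<And>i. integrable Q0 (s i)" "\<And>i. avg_approx (s i)"
    and lim: "\<And>x. x \<in> space Q0 \<Longrightarrow> (\<lambda>i. s i x) \<longlonglongrightarrow> f x"
    and bd: "\<And>i x. x \<in> space Q0 \<Longrightarrow> norm (s i x) \<le> 2 * norm (f x)"
    and f: "integrable Q0 f"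
  shows "avg_approx f"
  unfolding avg_approx_def
proof (intro allI impI)
  fix \<eta> :: real assume \<eta>: "0 < \<eta>"
  have "(\<lambda>i. \<integral>x. \<bar>f x - s i x\<bar> \<partial>Q0) \<longlonglongrightarrow> (\<integral>x. 0 \<partial>Q0)"
  proof (rule integral_dominated_convergence[where w = "\<lambda>x. 3 * \<bar>f x\<bar>"])
    show "AE x in Q0. (\<lambda>i. \<bar>f x - s i x\<bar>) \<longlonglongrightarrow> 0"
    proof (rule AE_I2)
      fix x assume "x \<in> space Q0"
      then have "(\<lambda>i. \<bar>f x - s i x\<bar>) \<longlonglongrightarrow> \<bar>f x - f x\<bar>" by (intro tendsto_intros lim)
      then show "(\<lambda>i. \<bar>f x - s i x\<bar>) \<longlonglongrightarrow> 0" by simp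
    qed
    show "AE x in Q0. norm \<bar>f x - s i x\<bar> \<le> 3 * \<bar>f x\<bar>" for i
    proof (rule AE_I2)
      fix x assume "x \<in> space Q0"
      from bd[OF this, of i] show "norm \<bar>f x - s i x\<bar> \<le> 3 * \<bar>f x\<bar>"
        unfolding real_norm_def by linarith
    qed
    show "integrable Q0 (\<lambda>x. 3 * \<bar>f x\<bar>)"
      by (intro integrable_mult_right integrable_abs f)
    show "(\<lambda>x. \<bar>f x - s i x\<bar>) \<in> borel_measurable Q0" for i
      by (intro borel_measurable_abs borel_measurable_diff borel_measurable_integrable f s(1))
  qed simp
  \<comment> \<open>A quarter, since \<open>abs_avg_err_le\<close> doubles it to half of
    \<open>\<eta>\<close>; the other half is left for \<open>s i\<close>.\<close>
  then have "\<forall>\<^sub>F i in sequentially. (\<integral>x. \<bar>f x - s i x\<bar> \<partial>Q0) < \<eta> / 4"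
    using \<eta> by (intro order_tendstoD(2)) auto
  then obtain i where i: "(\<integral>x. \<bar>f x - s i x\<bar> \<partial>Q0) < \<eta> / 4"
    unfolding eventually_sequentially by blast
  obtain N where N: "\<And>n B. n \<ge> N \<Longrightarrow> B \<in> sets Q0 \<Longrightarrow> \<bar>avg_err (s i) n 0 unit_rect B\<bar> \<le> \<eta> / 2"
    using s(2)[of i] half_gt_zero[OF \<eta>] unfolding avg_approx_def by blast
  have "\<bar>avg_err f n 0 unit_rect B\<bar> \<le> \<eta>" if n: "n \<ge> N" "B \<in> sets Q0" for n B
  proof -
    have d: "integrable Q0 (\<lambda>x. f x - s i x)" using f s(1) by simp
    have "avg_err f n 0 unit_rect B =
        avg_err (s i) n 0 unit_rect B + avg_err (\<lambda>x. f x - s i x) n 0 unit_rect B"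
      using avg_err_add[OF s(1)[of i] d unit_rect_node n(2), of n 0] by simp
    moreover have "(LINT x:rect_set unit_rect|Q0. \<bar>f x - s i x\<bar>) = (\<integral>x. \<bar>f x - s i x\<bar> \<partial>Q0)"
      using set_integral_space[OF integrable_abs[OF d]] by (simp add: space_Q0)
    then have "\<bar>avg_err (\<lambda>x. f x - s i x) n 0 unit_rect B\<bar> \<le> \<eta> / 2"
      using abs_avg_err_le[OF d unit_rect_node n(2), of n 0] i by linarith
    ultimately show ?thesis using N[OF n] by linarith
  qed
  then show "\<exists>N. \<forall>n\<ge>N. \<forall>B\<in>sets Q0. \<bar>avg_err f n 0 unit_rect B\<bar> \<le> \<eta>" by blast
qed

lemma integrable_indicator_Q0: "C \<in> sets Q0 \<Longrightarrow> integrable Q0 (indicator C :: _ \<Rightarrow> real)"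
  by (simp add: less_top[symmetric])

lemma avg_approx_cell:
  assumes "C \<in> cells e c"
  shows "avg_approx (indicator (rect_set C))"
  unfolding avg_approx_def
proof (intro allI impI)
  fix \<eta> :: real assume "0 < \<eta>"
  then show "\<exists>N. \<forall>n\<ge>N. \<forall>B\<in>sets Q0. \<bar>avg_err (indicator (rect_set C)) n 0 unit_rect B\<bar> \<le> \<eta>"
    using avg_err_cell[OF assms, of unit_rect 0] by (intro exI[of _ c]) simp
qed

lemma avg_approx_empty: "avg_approx (indicator {})"
proof -
  have eq: "indicator {} = (\<lambda>x. 0 * indicator (rect_set unit_rect) x :: real)"
    by (simp add: fun_eq_iff)
  show ?thesis
    unfolding eq by (rule avg_approx_cmult[OF avg_approx_cell[of _ 0]]) simp
qed

text \<open>Dynkin's pi-lambda theorem with the cells as generator. A countable disjoint union is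
  the dominated limit of its finite partial unions, which are handled by additivity.\<close>

lemma avg_approx_indicator:
  assumes "C \<in> sets Q0"
  shows "avg_approx (indicator C)"
proof -
  let ?U = "rect_set unit_rect" and ?G = "insert {} (\<Union>n. rect_set ` cells e n)"
  have G: "?G \<subseteq> Pow ?U" using cells_nodes rect_set_subset_unit by blast
  have sets: "sets Q0 = sigma_sets ?U ?G"
    using sets_Q0 sets_cube_borel_cells[OF recurrent] by simp
  have "C \<in> sigma_sets ?U ?G" using assms sets by simp
  from Int_stable_cells G this show ?thesis
  proof (induction rule: sigma_sets_induct_disjoint)
    case (basic C)
    with avg_approx_cell avg_approx_empty show ?case by blast
  next
    case empty
    show ?case by (rule avg_approx_empty)
  next
    case (compl C)
    then have C: "C \<in> sets Q0" by (simp add: sets)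
    have "C \<subseteq> ?U" using sets.sets_into_space[OF C] space_Q0 by simp
    then have eq: "indicator (?U - C) = (\<lambda>x. indicator ?U x + (-1) * indicator C x :: real)"
      by (auto simp: fun_eq_iff split: split_indicator)
    have "avg_approx (indicator ?U)" by (rule avg_approx_cell[of _ 0]) simp
    then show ?case
      unfolding eq
      by (intro avg_approx_add avg_approx_cmult integrable_mult_right integrable_indicator_Q0 C
          node_measurable[OF unit_rect_node] compl.IH)
  next
    case (union C)
    then have C: "C i \<in> sets Q0" for i using sets by blast
    have mUN: "(\<Union>i<m. C i) \<in> sets Q0" "(\<Union>i. C i) \<in> sets Q0" for m
      using C by blast+
    have fin: "avg_approx (indicator (\<Union>i<m. C i))" for m
    proof (induction m)
      case 0
      show ?case using avg_approx_empty by (simp only: lessThan_0 UN_empty)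
    next
      case (Suc m)
      have "C i \<inter> C m = {}" if "i < m" for i
        using disjoint_family_onD[OF union(1), of i m] that by simp
      then have "(\<Union>i<m. C i) \<inter> C m = {}" by blast
      then have eq: "indicator (\<Union>i<Suc m. C i) = (\<lambda>x. indicator (\<Union>i<m. C i) x + indicator (C m) x :: real)"
        by (auto simp: fun_eq_iff lessThan_Suc split: split_indicator)
      show ?case
        unfolding eq
        by (intro avg_approx_add integrable_indicator_Q0 Suc.IH union.IH C mUN)
    qed
    show ?case
    proof (rule avg_approx_lim[where s = "\<lambda>m. indicator (\<Union>i<m. C i)"])
      show "(\<lambda>m. indicator (\<Union>i<m. C i) x) \<longlonglongrightarrow> (indicator (\<Union>i. C i) x :: real)" for x
        by (rule LIMSEQ_indicator_UN)
      show "norm (indicator (\<Union>i<m. C i) x :: real) \<le> 2 * norm (indicator (\<Union>i. C i) x :: real)" for m x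
        by (auto split: split_indicator)
    qed (intro integrable_indicator_Q0 mUN fin)+
  qed
qed

lemma avg_approx_integrable:
  assumes "integrable Q0 f"
  shows "avg_approx f"
  using assms
proof (induction rule: integrable_induct)
  case (base A c)
  have eq: "(\<lambda>x. indicator A x *\<^sub>R c) = (\<lambda>x. c * indicator A x)"
    by (simp add: fun_eq_iff)
  show ?case
    unfolding eq by (rule avg_approx_cmult[OF avg_approx_indicator[OF base(1)]])
next
  case (add f g)
  then show ?case by (rule avg_approx_add)
next
  case (lim f s)
  show ?case by (rule avg_approx_lim[of s f]) (fact lim)+
qed

lemma averaged_tendsto:
  assumes F: "prob_space F" "sets F = sets Q0" "absolutely_continuous Q0 F" and \<eta>: "0 < \<eta>"
  shows "\<exists>N. \<forall>n\<ge>N. \<forall>B\<in>sets Q0.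
    \<bar>averaged (\<lambda>A. measure F (rect_set A)) n 0 unit_rect B - measure F B\<bar> \<le> \<eta>"
proof -
  define f where "f = rn_dens Q0 F"
  note f = integrable_rn_dens[OF prob_space_axioms F, folded f_def]
    and mass = measure_eq_rn_dens[OF prob_space_axioms F, folded f_def]
  obtain N where N: "\<And>n B. n \<ge> N \<Longrightarrow> B \<in> sets Q0 \<Longrightarrow> \<bar>avg_err f n 0 unit_rect B\<bar> \<le> \<eta>"
    using avg_approx_integrable[OF f] \<eta> unfolding avg_approx_def by blast
  have "\<bar>averaged (\<lambda>A. measure F (rect_set A)) n 0 unit_rect B - measure F B\<bar> \<le> \<eta>"
    if n: "n \<ge> N" "B \<in> sets Q0" for n B
  proof -
    have "averaged (\<lambda>A. measure F (rect_set A)) n 0 unit_rect B =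
        averaged (\<lambda>A. LINT x:rect_set A|Q0. f x) n 0 unit_rect B"
      by (rule averaged_cong[OF mass[OF node_measurable] unit_rect_node])
    moreover have "rect_set unit_rect \<inter> B = B"
      using sets.sets_into_space[OF n(2)] space_Q0 by auto
    ultimately show ?thesis using N[OF n] mass[OF n(2)] by (simp add: avg_err_def)
  qed
  then show ?thesis by blast
qed

end

section \<open>Measurability of total variation balls\<close>

text \<open>Truncate the density of \<open>Q\<close> at a level \<open>n\<close> whose excess
  integrates to less than half of \<open>\<epsilon>\<close>. On \<open>C\<close> the truncated part
  contributes at most \<open>n\<close> times the mass of \<open>C\<close> under
  \<open>Q0\<close>.\<close>

lemma absolutely_continuous_eps_delta:
  assumes Q0: "prob_space Q0" and Q: "prob_space Q" "sets Q = sets Q0" "absolutely_continuous Q0 Q"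
    and \<epsilon>: "0 < \<epsilon>"
  shows "\<exists>\<delta>>0. \<forall>C\<in>sets Q0. measure Q0 C < \<delta> \<longrightarrow> measure Q C < \<epsilon>"
proof -
  interpret Q0: prob_space Q0 by fact
  define q where "q = rn_dens Q0 Q"
  have q0: "0 \<le> q x" for x by (simp add: q_def rn_dens_nonneg)
  have q: "integrable Q0 q" unfolding q_def by (rule integrable_rn_dens[OF Q0 Q])
  have q_min: "integrable Q0 (\<lambda>x. q x - min (q x) (real n))" for n
    using q by (intro Bochner_Integration.integrable_diff integrable_min) auto
  have "(\<lambda>n. \<integral>x. q x - min (q x) (real n) \<partial>Q0) \<longlonglongrightarrow> (\<integral>x. 0 \<partial>Q0)"
  proof (rule integral_dominated_convergence[OF _ _ q])
    show "AE x in Q0. (\<lambda>n. q x - min (q x) (real n)) \<longlonglongrightarrow> 0"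
    proof (rule AE_I2)
      fix x
      obtain m where m: "q x \<le> real m" using real_arch_simple by blast
      then have "q x - min (q x) (real n) = 0" if "n \<ge> m" for n
        using that by (auto simp: min_def)
      then have "\<forall>\<^sub>F n in sequentially. q x - min (q x) (real n) = 0"
        unfolding eventually_sequentially by blast
      then show "(\<lambda>n. q x - min (q x) (real n)) \<longlonglongrightarrow> 0"
        by (rule tendsto_eventually)
    qed
    show "AE x in Q0. norm (q x - min (q x) (real n)) \<le> q x" for n
      using q0 by (intro AE_I2) (auto simp: min_def)
    show "(\<lambda>x. q x - min (q x) (real n)) \<in> borel_measurable Q0" for n
      using q_min by (rule borel_measurable_integrable)
  qed simp
  then have "\<forall>\<^sub>F n in sequentially. (\<integral>x. q x - min (q x) (real n) \<partial>Q0) < \<epsilon> / 2"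
    using \<epsilon> by (intro order_tendstoD(2)) auto
  then obtain n where n: "(\<integral>x. q x - min (q x) (real n) \<partial>Q0) < \<epsilon> / 2"
    unfolding eventually_sequentially by blast
  \<comment> \<open>Chosen so that the truncated part contributes at most half of
    \<open>\<epsilon>\<close>; \<open>n + 1\<close> avoids division by 0.\<close>
  define \<delta> where "\<delta> = \<epsilon> / (2 * (real n + 1))"
  have "measure Q C < \<epsilon>" if C: "C \<in> sets Q0" "measure Q0 C < \<delta>" for C
  proof -
    have "measure Q C = (\<integral>x. indicator C x *\<^sub>R q x \<partial>Q0)"
      unfolding measure_eq_rn_dens[OF Q0 Q C(1)] by (simp add: set_lebesgue_integral_def q_def)
    also have "\<dots> \<le> (\<integral>x. real n * indicator C x + (q x - min (q x) (real n)) \<partial>Q0)"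
    proof (rule integral_mono)
      show "integrable Q0 (\<lambda>x. indicator C x *\<^sub>R q x)"
        using C(1) q by (rule integrable_mult_indicator)
      show "integrable Q0 (\<lambda>x. real n * indicator C x + (q x - min (q x) (real n)))"
        using C(1) by (intro Bochner_Integration.integrable_add q_min integrable_mult_right)
          (simp add: less_top[symmetric])
      show "indicator C x *\<^sub>R q x \<le> real n * indicator C x + (q x - min (q x) (real n))" for x
        using q0[of x] by (auto split: split_indicator)
    qed
    also have "\<dots> = real n * measure Q0 C + (\<integral>x. q x - min (q x) (real n) \<partial>Q0)"
      using C(1) q_min[of n] sets.sets_into_space[OF C(1)]
      by (subst Bochner_Integration.integral_add) (auto simp: less_top[symmetric] Int_absorb2)
    also have "real n * measure Q0 C \<le> (real n + 1) * \<delta>"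
      using C(2) by (intro mult_mono) auto
    also have "(real n + 1) * \<delta> = \<epsilon> / 2"
      by (simp add: \<delta>_def field_simps)
    finally show ?thesis using n by simp
  qed
  moreover have "0 < \<delta>" using \<epsilon> by (simp add: \<delta>_def)
  ultimately show ?thesis by blast
qed

text \<open>One set of the family has to serve two measures at once, because absolute continuity
  compares \<open>Q\<close> with \<open>Q0\<close> and the L1 distance compares \<open>Q\<close>
  with \<open>F\<close> on the same set. The family itself does not depend on the measures.\<close>

definition approximating :: "'a measure \<Rightarrow> 'a set set \<Rightarrow> bool" where
  "approximating M \<C> \<longleftrightarrow> countable \<C> \<and> \<C> \<subseteq> sets M \<and>
    (\<forall>P Q B \<epsilon>. P \<in> space (prob_algebra M) \<longrightarrow> Q \<in> space (prob_algebra M) \<longrightarrow> B \<in> sets M \<longrightarrow>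
       0 < \<epsilon> \<longrightarrow> (\<exists>C\<in>\<C>. \<bar>measure P C - measure P B\<bar> < \<epsilon> \<and> \<bar>measure Q C - measure Q B\<bar> < \<epsilon>))"

text \<open>By outer regularity each measure has an open superset of \<open>B\<close> of nearly the
  same mass, and the intersection of the two works for both. It is a countable union of basic open
  sets, and the masses of finite subunions converge to its mass.\<close>

lemma finite_union_approx:
  fixes \<B> :: "'a::{second_countable_topology, complete_space} set set"
  assumes basis: "topological_basis \<B>" "countable \<B>" and P: "prob_space P" "sets P = sets borel"
    and Q: "prob_space Q" "sets Q = sets borel"
    and B: "B \<in> sets borel" and \<epsilon>: "0 < \<epsilon>"
  shows "\<exists>X. finite X \<and> X \<subseteq> \<B> \<and> \<bar>measure P (\<Union>X) - measure P B\<bar> < \<epsilon> \<and> \<bar>measure Q (\<Union>X) - measure Q B\<bar> < \<epsilon>"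
proof -
  have outer: "\<exists>U. B \<subseteq> U \<and> open U \<and> measure R U < measure R B + \<epsilon>" if R: "prob_space R" "sets R = sets borel" for R
  proof -
    interpret R: prob_space R by fact
    have "(INF U\<in>{U. B \<subseteq> U \<and> open U}. emeasure R U) < ennreal (measure R B + \<epsilon>)"
      using outer_regular[OF R(2) _ B] \<epsilon>
      by (subst outer_regular[OF R(2) _ B, symmetric]) (auto simp: R.emeasure_eq_measure ennreal_less_iff)
    then obtain U where "B \<subseteq> U" "open U" "emeasure R U < ennreal (measure R B + \<epsilon>)"
      unfolding INF_less_iff by blast
    moreover from this(3) have "measure R U < measure R B + \<epsilon>"
      unfolding R.emeasure_eq_measure by (simp add: ennreal_less_iff del: ennreal_plus)
    ultimately show ?thesis by blast
  qed
  obtain U1 where U1: "B \<subseteq> U1" "open U1" "measure P U1 < measure P B + \<epsilon>" using outer[OF P] by blast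
  obtain U2 where U2: "B \<subseteq> U2" "open U2" "measure Q U2 < measure Q B + \<epsilon>" using outer[OF Q] by blast
  let ?U = "U1 \<inter> U2"
  obtain Y where Y: "Y \<subseteq> \<B>" "\<Union>Y = ?U"
    using basis(1) open_Int[OF U1(2) U2(2)] unfolding topological_basis_def by metis
  have cY: "countable Y" using Y(1) basis(2) by (rule countable_subset)
  \<comment> \<open>The first members of \<open>Y\<close> in a fixed enumeration: finite,
    increasing, and with union all of \<open>Y\<close>.\<close>
  define X where "X n = {b \<in> Y. to_nat_on Y b < n}" for n
  have finX: "finite (X n)" for n
    unfolding X_def
    using finite_imageD[of "to_nat_on Y" "{b \<in> Y. to_nat_on Y b < n}"]
      inj_on_subset[OF inj_on_to_nat_on[OF cY]]
    by (auto intro: finite_subset[of _ "{..<n}"])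
  have lim: "(\<lambda>n. measure R (\<Union>(X n))) \<longlonglongrightarrow> measure R ?U"
    if R: "prob_space R" "sets R = sets borel" for R
  proof -
    interpret R: prob_space R by fact
    have "(\<Union>n. \<Union>(X n)) = ?U"
      unfolding Y(2)[symmetric] by (auto simp: X_def)
    moreover have "range (\<lambda>n. \<Union>(X n)) \<subseteq> sets R"
      using topological_basis_open[OF basis(1)] Y(1) unfolding R(2) X_def
      by (auto intro!: borel_open open_Union)
    moreover have "incseq (\<lambda>n. \<Union>(X n))"
      by (intro incseq_SucI) (auto simp: X_def)
    ultimately show ?thesis using R.finite_Lim_measure_incseq by metis
  qed
  have ev: "\<forall>\<^sub>F n in sequentially. \<bar>measure R (\<Union>(X n)) - measure R B\<bar> < \<epsilon>"
    if R: "prob_space R" "sets R = sets borel" and less: "measure R ?U < measure R B + \<epsilon>" for R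
  proof -
    interpret R: prob_space R by fact
    have "measure R B \<le> measure R ?U"
      using U1(1,2) U2(1,2) R(2) by (intro R.finite_measure_mono) auto
    then have "\<bar>measure R ?U - measure R B\<bar> < \<epsilon>" using less by linarith
    moreover have "(\<lambda>n. \<bar>measure R (\<Union>(X n)) - measure R B\<bar>) \<longlonglongrightarrow> \<bar>measure R ?U - measure R B\<bar>"
      by (intro tendsto_intros lim R)
    ultimately show ?thesis by (rule order_tendstoD(2)[rotated])
  qed
  have "measure P ?U \<le> measure P U1" "measure Q ?U \<le> measure Q U2"
    using U1(2) U2(2) P Q
    by (auto intro!: finite_measure.finite_measure_mono prob_space.finite_measure)
  then have "\<forall>\<^sub>F n in sequentially. \<bar>measure P (\<Union>(X n)) - measure P B\<bar> < \<epsilon> \<and>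
      \<bar>measure Q (\<Union>(X n)) - measure Q B\<bar> < \<epsilon>"
    using U1(3) U2(3) by (intro eventually_conj ev P Q) linarith+
  then obtain n where "\<bar>measure P (\<Union>(X n)) - measure P B\<bar> < \<epsilon>" "\<bar>measure Q (\<Union>(X n)) - measure Q B\<bar> < \<epsilon>"
    unfolding eventually_sequentially by blast
  moreover have "X n \<subseteq> \<B>" using Y(1) by (auto simp: X_def)
  ultimately show ?thesis using finX by blast
qed

lemma approximating_exists: "\<exists>\<C>. approximating (cube_borel :: (real ^ 'p::finite) measure) \<C>"
proof -
  let ?U = "rect_set unit_rect :: (real ^ 'p) set"
  obtain \<B> :: "(real ^ 'p) set set" where \<B>: "countable \<B>" "topological_basis \<B>"
    using ex_countable_basis by blast
  define \<C> where "\<C> = (\<lambda>X. \<Union>X \<inter> ?U) ` {X. finite X \<and> X \<subseteq> \<B>}"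
  have "countable \<C>"
    unfolding \<C>_def by (intro countable_image countable_Collect_finite_subset \<B>)
  moreover have "\<C> \<subseteq> sets cube_borel"
  proof
    fix C assume "C \<in> \<C>"
    then obtain X where X: "X \<subseteq> \<B>" "C = \<Union>X \<inter> ?U" by (auto simp: \<C>_def)
    have "open (\<Union>X)" using topological_basis_open[OF \<B>(2)] X(1) by blast
    then show "C \<in> sets cube_borel" using X(2) by (simp add: sets_cube_borel_iff)
  qed
  moreover have "\<exists>C\<in>\<C>. \<bar>measure P C - measure P B\<bar> < \<epsilon> \<and> \<bar>measure Q C - measure Q B\<bar> < \<epsilon>"
    if P: "P \<in> space (prob_algebra cube_borel)" and Q: "Q \<in> space (prob_algebra cube_borel)"
      and B: "B \<in> sets cube_borel" and \<epsilon>: "0 < \<epsilon>" for P Q B \<epsilon>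
  proof -
    \<comment> \<open>Outer regularity concerns Borel measures on the whole space, so measures on
      the cube are first pushed forward along the inclusion.\<close>
    define ext where "ext R = distr R borel (\<lambda>x. x)" for R :: "(real ^ 'p) measure"
    have ext: "prob_space (ext R)" "sets (ext R) = sets borel"
        "\<And>C. C \<in> sets borel \<Longrightarrow> measure (ext R) C = measure R (C \<inter> ?U)"
      if R: "R \<in> space (prob_algebra cube_borel)" for R
    proof -
      interpret R: prob_space R using R by (simp add: space_prob_algebra)
      have s: "sets R = sets cube_borel" using R by (simp add: space_prob_algebra)
      have sp: "space R = ?U" using sets_eq_imp_space_eq[OF s] by simp
      have m: "(\<lambda>x. x) \<in> measurable R borel"
        unfolding measurable_cong_sets[OF s refl] cube_borel_def by (intro measurable_restrict_space1) simp
      show "prob_space (ext R)" unfolding ext_def by (rule R.prob_space_distr[OF m])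
      show "sets (ext R) = sets borel" by (simp add: ext_def)
      show "measure (ext R) C = measure R (C \<inter> ?U)" if "C \<in> sets borel" for C
        unfolding ext_def using that m by (simp add: measure_distr sp)
    qed
    have B': "B \<in> sets borel" "B \<inter> ?U = B" using B by (auto simp: sets_cube_borel_iff)
    obtain X where X: "finite X" "X \<subseteq> \<B>" "\<bar>measure (ext P) (\<Union>X) - measure (ext P) B\<bar> < \<epsilon>"
        "\<bar>measure (ext Q) (\<Union>X) - measure (ext Q) B\<bar> < \<epsilon>"
      using finite_union_approx[OF \<B>(2,1) ext(1,2)[OF P] ext(1,2)[OF Q] B'(1) \<epsilon>] by blast
    have "open (\<Union>X)" using topological_basis_open[OF \<B>(2)] X(2) by blast
    then have "\<Union>X \<in> sets borel" by simp
    then have "\<bar>measure P (\<Union>X \<inter> ?U) - measure P B\<bar> < \<epsilon>" "\<bar>measure Q (\<Union>X \<inter> ?U) - measure Q B\<bar> < \<epsilon>"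
      using X(3,4) B' ext(3)[OF P] ext(3)[OF Q] by simp_all
    moreover have "\<Union>X \<inter> ?U \<in> \<C>" using X(1,2) by (auto simp: \<C>_def)
    ultimately show ?thesis by blast
  qed
  ultimately show ?thesis unfolding approximating_def by blast
qed

text \<open>The epsilon-delta form of absolute continuity survives restriction to the family: a
  \<open>Q0\<close>-null set is close, under both measures, to a member of small
  \<open>Q0\<close>-mass, whose \<open>Q\<close>-mass is then small too.\<close>

lemma absolutely_continuous_iff_approximating:
  assumes \<C>: "approximating M \<C>" and Q0: "Q0 \<in> space (prob_algebra M)" and Q: "Q \<in> space (prob_algebra M)"
  shows "absolutely_continuous Q0 Q \<longleftrightarrow>
    (\<forall>m::nat. \<exists>n::nat. \<forall>C\<in>\<C>. measure Q0 C < 1 / real (Suc n) \<longrightarrow> measure Q C < 1 / real (Suc m))"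
proof
  have s: "sets Q0 = sets M" "sets Q = sets M" "prob_space Q0" "prob_space Q"
    using Q0 Q by (auto simp: space_prob_algebra)
  {
    assume ac: "absolutely_continuous Q0 Q"
    show "\<forall>m::nat. \<exists>n::nat. \<forall>C\<in>\<C>. measure Q0 C < 1 / real (Suc n) \<longrightarrow> measure Q C < 1 / real (Suc m)"
    proof
      fix m :: nat
      obtain \<delta> where \<delta>: "0 < \<delta>" "\<And>C. C \<in> sets Q0 \<Longrightarrow> measure Q0 C < \<delta> \<Longrightarrow> measure Q C < 1 / real (Suc m)"
        using absolutely_continuous_eps_delta[OF s(3,4) _ ac, of "1 / real (Suc m)"] s(1,2) by auto
      obtain n where "1 / real (Suc n) < \<delta>"
        using nat_approx_posE[OF \<delta>(1)] by blast
      then have "measure Q C < 1 / real (Suc m)" if "C \<in> \<C>" "measure Q0 C < 1 / real (Suc n)" for C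
        using \<delta>(2)[of C] that \<C> s(1) unfolding approximating_def by auto
      then show "\<exists>n::nat. \<forall>C\<in>\<C>. measure Q0 C < 1 / real (Suc n) \<longrightarrow> measure Q C < 1 / real (Suc m)"
        by blast
    qed
  next
    assume crit: "\<forall>m::nat. \<exists>n::nat. \<forall>C\<in>\<C>. measure Q0 C < 1 / real (Suc n) \<longrightarrow> measure Q C < 1 / real (Suc m)"
    show "absolutely_continuous Q0 Q"
      unfolding absolutely_continuous_def
    proof
      fix N assume N: "N \<in> null_sets Q0"
      \<comment> \<open>One share comes from the criterion applied to \<open>C\<close>, the other
        from replacing \<open>C\<close> by \<open>N\<close>.\<close>
      have small: "measure Q N < 2 / real (Suc m)" for m
      proof -
        obtain n where n: "\<And>C. C \<in> \<C> \<Longrightarrow> measure Q0 C < 1 / real (Suc n) \<Longrightarrow> measure Q C < 1 / real (Suc m)"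
          using crit by blast
        have "N \<in> sets M" "0 < min (1 / real (Suc n)) (1 / real (Suc m))" using N s(1) by auto
        then obtain C where C: "C \<in> \<C>" "\<bar>measure Q0 C - measure Q0 N\<bar> < min (1 / real (Suc n)) (1 / real (Suc m))"
            "\<bar>measure Q C - measure Q N\<bar> < min (1 / real (Suc n)) (1 / real (Suc m))"
          using \<C> Q0 Q unfolding approximating_def by blast
        have "measure Q0 N = 0" using N by (simp add: measure_def null_setsD1)
        then have "measure Q C < 1 / real (Suc m)" using n[OF C(1)] C(2) by simp
        then have "measure Q N < 1 / real (Suc m) + 1 / real (Suc m)" using C(3) by linarith
        then show ?thesis by simp
      qed
      have "measure Q N = 0"
      proof (rule ccontr)
        assume "measure Q N \<noteq> 0"
        then have "0 < measure Q N / 2" using measure_nonneg[of Q N] by linarith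
        from nat_approx_posE[OF this] obtain m where "1 / real (Suc m) < measure Q N / 2" .
        then show False using small[of m] by (simp add: field_simps)
      qed
      then show "N \<in> null_sets Q"
        using N s finite_measure.emeasure_eq_measure[OF prob_space.finite_measure[OF s(4)], of N]
        by (auto simp: null_sets_def)
    qed
  }
qed

text \<open>Strict inequality at every member of the family would only bound the supremum by
  \<open>\<tau>\<close>; the margin \<open>1 / Suc m\<close>, common to all members, keeps the
  inequality strict.\<close>

lemma rn_dens_L1_less_iff_approximating:
  assumes \<C>: "approximating M \<C>" and Q0: "Q0 \<in> space (prob_algebra M)"
    and Q: "Q \<in> space (prob_algebra M)" "absolutely_continuous Q0 Q"
    and F: "F \<in> space (prob_algebra M)" "absolutely_continuous Q0 F"
  shows "(\<integral>x. \<bar>rn_dens Q0 Q x - rn_dens Q0 F x\<bar> \<partial>Q0) < \<tau> \<longleftrightarrow>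
    (\<exists>m::nat. \<forall>C\<in>\<C>. 2 * (measure Q C - measure F C) \<le> \<tau> - 1 / real (Suc m))" (is "?I < \<tau> \<longleftrightarrow> ?R")
proof -
  have s: "sets Q0 = sets M" "sets Q = sets Q0" "sets F = sets Q0" "prob_space Q0" "prob_space Q" "prob_space F"
    using Q0 Q F by (auto simp: space_prob_algebra)
  note L1 = rn_dens_L1_eq[OF s(4) s(5,2) Q(2) s(6,3) F(2)]
  show ?thesis
  proof
    assume "?I < \<tau>"
    then obtain m where m: "1 / real (Suc m) < \<tau> - ?I"
      using nat_approx_posE[of "\<tau> - ?I"] by auto
    have "2 * (measure Q C - measure F C) \<le> \<tau> - 1 / real (Suc m)" if "C \<in> \<C>" for C
    proof -
      have "C \<in> sets Q0" using that \<C> s(1) unfolding approximating_def by blast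
      then show ?thesis using L1(2)[of C] m by linarith
    qed
    then show ?R by blast
  next
    assume ?R
    then obtain m where m: "\<And>C. C \<in> \<C> \<Longrightarrow> 2 * (measure Q C - measure F C) \<le> \<tau> - 1 / real (Suc m)"
      by blast
    obtain B where B: "B \<in> sets Q0" "?I = 2 * (measure Q B - measure F B)" using L1(1) by blast
    define r where "r = 1 / real (Suc m)"
    \<comment> \<open>Moving from \<open>C\<close> to the extremal set \<open>B\<close> changes two
      measures by less than \<open>r / 4\<close> each; after the factor 2 this stays below the
      margin \<open>r\<close>.\<close>
    have "0 < r / 4" by (simp add: r_def)
    then obtain C where C: "C \<in> \<C>" "\<bar>measure Q C - measure Q B\<bar> < r / 4"
        "\<bar>measure F C - measure F B\<bar> < r / 4"
      using \<C> Q(1) F(1) B(1) s(1) unfolding approximating_def by blast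
    have "2 * (measure Q C - measure F C) \<le> \<tau> - r"
      unfolding r_def by (rule m[OF C(1)])
    then have "2 * (measure Q B - measure F B) < \<tau>"
      using C(2,3) unfolding abs_diff_less_iff by (simp add: algebra_simps)
    then show "?I < \<tau>" using B(2) by simp
  qed
qed

text \<open>The two criteria write membership as countable quantifiers over conditions on single
  values \<open>measure Q C\<close>, which are measurable in \<open>Q\<close>.\<close>

lemma measurable_L1_ball:
  assumes Q0: "Q0 \<in> space (prob_algebra cube_borel)"
    and F: "F \<in> space (prob_algebra cube_borel)" "absolutely_continuous Q0 F"
  shows "{Q \<in> space (prob_algebra (cube_borel :: (real ^ 'p::finite) measure)). absolutely_continuous Q0 Q \<and>
      (\<integral>x. \<bar>rn_dens Q0 Q x - rn_dens Q0 F x\<bar> \<partial>Q0) < \<tau>} \<in> sets (prob_algebra cube_borel)"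
proof -
  let ?M = "cube_borel :: (real ^ 'p) measure"
  obtain \<C> where \<C>: "approximating ?M \<C>" using approximating_exists by blast
  then have c: "countable \<C>" and [measurable]: "\<And>C. C \<in> \<C> \<Longrightarrow> C \<in> sets ?M"
    by (auto simp: approximating_def)
  have "{Q \<in> space (prob_algebra ?M). absolutely_continuous Q0 Q \<and>
      (\<integral>x. \<bar>rn_dens Q0 Q x - rn_dens Q0 F x\<bar> \<partial>Q0) < \<tau>} =
    {Q \<in> space (prob_algebra ?M).
      (\<forall>m::nat. \<exists>n::nat. \<forall>C\<in>\<C>. measure Q0 C < 1 / real (Suc n) \<longrightarrow> measure Q C < 1 / real (Suc m)) \<and>
      (\<exists>m::nat. \<forall>C\<in>\<C>. 2 * (measure Q C - measure F C) \<le> \<tau> - 1 / real (Suc m))}"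
    using absolutely_continuous_iff_approximating[OF \<C> Q0]
      rn_dens_L1_less_iff_approximating[OF \<C> Q0 _ _ F] by blast
  also have "\<dots> \<in> sets (prob_algebra ?M)"
  proof -
    have m [measurable]: "(\<lambda>Q. measure Q C) \<in> borel_measurable (prob_algebra ?M)" if "C \<in> \<C>" for C
      using that by measurable
    have 1: "Measurable.pred (prob_algebra ?M) (\<lambda>Q. \<forall>C\<in>\<C>. measure Q0 C < 1 / real (Suc n) \<longrightarrow> measure Q C < 1 / real (Suc k))" for n k
      by (intro measurable_pred_countable(1)[OF c]) measurable
    have 2: "Measurable.pred (prob_algebra ?M) (\<lambda>Q. \<forall>C\<in>\<C>. 2 * (measure Q C - measure F C) \<le> \<tau> - 1 / real (Suc k))" for k
      by (intro measurable_pred_countable(1)[OF c]) measurable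
    show ?thesis
      using 1 2 by measurable
  qed
  finally show ?thesis .
qed

section \<open>Runs that divide and then stop\<close>

lemma run_mass_le_Suc: "run_mass Q0 t S J Y n A h q B \<le> run_mass Q0 t S J Y (Suc n) A h q B"
proof (induction n arbitrary: A h q)
  case (Suc n)
  let ?g = "S (A, h)"
  show ?case
  proof (cases "?g = Stop")
    case False
    then show ?thesis
      by (subst (1 2) run_mass.simps(2)) (simp only: Let_def if_False add_mono Suc.IH)
  qed simp
qed simp

lemma run_mass_mono: "m \<le> n \<Longrightarrow> run_mass Q0 t S J Y m A h q B \<le> run_mass Q0 t S J Y n A h q B"
  by (rule lift_Suc_mono_le[where f = "\<lambda>n. run_mass Q0 t S J Y n A h q B"]) (rule run_mass_le_Suc)

lemma run_mass_empty: "run_mass Q0 t S J Y n A h q {} = 0"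
  by (induction n arbitrary: A h q) (simp_all add: Let_def)

lemma run_mass_suminf:
  assumes "range B \<subseteq> sets Q0" "disjoint_family B"
  shows "(\<Sum>i. run_mass Q0 t S J Y n A h q (B i)) = run_mass Q0 t S J Y n A h q (\<Union>i. B i)"
proof (induction n arbitrary: A h q)
  case (Suc n)
  show ?case
  proof (cases "S (A, h) = Stop")
    case True
    have "(\<Sum>i. emeasure (uniform_measure Q0 (rect_set A)) (B i)) = emeasure (uniform_measure Q0 (rect_set A)) (\<Union>i. B i)"
      using assms by (intro suminf_emeasure) auto
    then show ?thesis using True by (simp add: Let_def ennreal_suminf_cmult)
  next
    case False
    then show ?thesis
      by (simp add: Let_def suminf_add[OF summableI summableI, symmetric] Suc.IH)
  qed
qed simp

lemma run_mass_null:
  assumes "B \<in> null_sets Q0" "A \<in> nodes" "\<And>A. A \<in> nodes \<Longrightarrow> rect_set A \<in> sets Q0"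
  shows "run_mass Q0 t S J Y n A h q B = 0"
  using assms(2)
proof (induction n arbitrary: A h q)
  case (Suc n)
  have "emeasure (uniform_measure Q0 (rect_set A)) B = 0"
    using assms(1) assms(3)[OF Suc.prems]
    by (subst emeasure_uniform_measure) (auto simp: null_sets_def intro: emeasure_eq_0[of B])
  then show ?case
    using Suc.IH half_nodes[OF Suc.prems] by (simp add: Let_def)
qed simp

lemma sets_dmmt_measure: "sets (dmmt_measure Q0 t \<omega>) = sets cube_borel"
  by (cases \<omega>) (simp add: dmmt_measure_def del: space_cube_borel)

text \<open>\<open>measure_of\<close> has the intended values only for a countably additive set
  function. Sum and supremum may be exchanged because the masses increase with the number of
  generations.\<close>

lemma emeasure_dmmt_measure:
  assumes "sets Q0 = sets cube_borel" "B \<in> sets cube_borel"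
  shows "emeasure (dmmt_measure Q0 t (h0, S, J, Y)) B = (SUP n. run_mass Q0 t S J Y n unit_rect h0 1 B)"
proof (rule emeasure_measure_of)
  show "dmmt_measure Q0 t (h0, S, J, Y) = measure_of (space cube_borel) (sets cube_borel)
       (\<lambda>B. SUP n. run_mass Q0 t S J Y n unit_rect h0 1 B)"
    by (simp add: dmmt_measure_def)
  show "countably_additive (sets (dmmt_measure Q0 t (h0, S, J, Y)))
      (\<lambda>B. SUP n. run_mass Q0 t S J Y n unit_rect h0 1 B)"
  proof (rule countably_additiveI)
    fix C :: "nat \<Rightarrow> (real ^ 'a) set"
    assume C: "range C \<subseteq> sets (dmmt_measure Q0 t (h0, S, J, Y))" "disjoint_family C"
    have "(\<Sum>i. SUP n. run_mass Q0 t S J Y n unit_rect h0 1 (C i)) =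
        (SUP n. \<Sum>i. run_mass Q0 t S J Y n unit_rect h0 1 (C i))"
      by (rule ennreal_suminf_SUP_eq) (intro incseq_SucI run_mass_le_Suc)
    also have "\<dots> = (SUP n. run_mass Q0 t S J Y n unit_rect h0 1 (\<Union>i. C i))"
      using C assms(1) by (subst run_mass_suminf) (auto simp: sets_dmmt_measure)
    finally show "(\<Sum>i. SUP n. run_mass Q0 t S J Y n unit_rect h0 1 (C i)) =
      (SUP n. run_mass Q0 t S J Y n unit_rect h0 1 (\<Union>i. C i))" .
  qed
  show "positive (sets (dmmt_measure Q0 t (h0, S, J, Y)))
      (\<lambda>B. SUP n. run_mass Q0 t S J Y n unit_rect h0 1 B)"
    by (simp add: positive_def run_mass_empty)
qed (use assms in \<open>auto simp: sets_dmmt_measure sets_cube_borel_iff\<close>)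

text \<open>True for every draw, not only almost surely: all mass is placed by conditional versions
  of \<open>Q0\<close>, which vanish on \<open>Q0\<close>-null sets.\<close>

lemma (in dyadic_base) absolutely_continuous_dmmt_measure:
  "absolutely_continuous Q0 (dmmt_measure Q0 t \<omega>)"
proof -
  obtain h0 S J Y where \<omega>: "\<omega> = (h0, S, J, Y)" by (cases \<omega>)
  have "emeasure (dmmt_measure Q0 t \<omega>) B = 0" if B: "B \<in> null_sets Q0" for B
  proof -
    have "B \<in> sets cube_borel" using B sets_Q0 by auto
    then show ?thesis
      using run_mass_null[OF B unit_rect_node node_measurable]
      unfolding \<omega> by (simp add: emeasure_dmmt_measure[OF sets_Q0])
  qed
  then show ?thesis
    unfolding absolutely_continuous_def null_sets_def sets_dmmt_measure sets_Q0 by auto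
qed

text \<open>The good event for one sample \<open>t\<close> with target \<open>F\<close>. All nodes
  up to level \<open>K\<close> are constrained, visited or not, so the conditions need not refer to
  the course of the run. The root is looked up under \<open>h0\<close>, all other nodes under
  Divide.\<close>

locale stopping_draws = dyadic_base Q0 e + F: prob_space F
  for Q0 F :: "(real ^ 'p::finite) measure" and e :: "nat \<Rightarrow> 'p" +
  fixes K t :: nat and \<delta> :: real and h0 :: gstate
    and S :: "'p rect \<times> gstate \<Rightarrow> gstate" and J :: "'p rect \<times> gstate \<Rightarrow> 'p"
    and Y :: "'p rect \<times> gstate \<times> 'p \<times> nat \<Rightarrow> real"
  assumes sets_F: "sets F = sets cube_borel"
    and \<delta>: "0 < \<delta>"
    and divide: "\<And>A k. A \<in> level_nodes k \<Longrightarrow> k < K \<Longrightarrow> S (A, Divide) = Divide"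
    and stop: "\<And>A. A \<in> level_nodes K \<Longrightarrow> S (A, Divide) = Stop"
    and root: "S (unit_rect, h0) = S (unit_rect, Divide)"
    and dir: "\<And>A k. A \<in> level_nodes k \<Longrightarrow> k < K \<Longrightarrow> J (A, Divide) = e k"
    and proportion: "\<And>A k. A \<in> level_nodes k \<Longrightarrow> k < K \<Longrightarrow> Y (A, Divide, e k, t) \<in>
      {y. 0 < y \<and> y < 1 \<and> \<bar>y - measure F (rect_set (left_half (e k) A)) / measure F (rect_set A)\<bar> < \<delta>}"
begin

text \<open>The error inherited from \<open>A\<close> is shared between the halves in proportions
  \<open>y\<close> and \<open>1 - y\<close>, so its total does not grow. The inexact proportion
  moves at most \<open>\<delta>\<close> times the mass of \<open>A\<close> from one half to the
  other, which counts twice.\<close>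

lemma split_error:
  fixes q y :: real
  assumes A: "A \<in> level_nodes k" "k < K" and y: "y = Y (A, Divide, e k, t)"
  shows "\<bar>q * y - measure F (rect_set (left_half (e k) A))\<bar>
      + \<bar>q * (1 - y) - measure F (rect_set (right_half (e k) A))\<bar>
    \<le> \<bar>q - measure F (rect_set A)\<bar> + 2 * \<delta> * measure F (rect_set A)"
proof -
  let ?L = "rect_set (left_half (e k) A)" and ?R = "rect_set (right_half (e k) A)"
  define a l r where "a = measure F (rect_set A)" and "l = measure F ?L" and "r = measure F ?R"
  have A': "A \<in> nodes" using A(1) level_nodes_subset_nodes by blast
  have m: "?L \<in> sets F" "?R \<in> sets F"
    using half_nodes[OF A'] by (simp_all add: sets_F sets_cube_borel_node)
  have sum: "a = l + r"
    unfolding a_def l_def r_def rect_set_halves[OF A', of "e k"]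
    by (rule F.finite_measure_Union[OF m rect_set_halves_disjoint])
  have pos: "0 \<le> l" "0 \<le> r" by (simp_all add: l_def r_def)
  have yy: "0 < y" "y < 1" "\<bar>y - l / a\<bar> < \<delta>" using proportion[OF A] unfolding y l_def a_def by auto
  \<comment> \<open>For \<open>a = 0\<close> also \<open>l = 0\<close>, and the quotient is 0 by
    convention.\<close>
  have la: "a * (l / a) = l" using sum pos by (cases "a = 0") auto
  define d where "d = a * (y - l / a)"
  have "\<bar>d\<bar> \<le> a * \<delta>"
    unfolding d_def abs_mult using yy(3) sum pos by (simp add: mult_left_mono)
  moreover have "q * y - l = (q - a) * y + d" "q * (1 - y) - r = (q - a) * (1 - y) - d"
    using la sum by (simp_all add: d_def algebra_simps)
  moreover have "\<bar>(q - a) * y\<bar> + \<bar>(q - a) * (1 - y)\<bar> = \<bar>q - a\<bar>"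
    unfolding abs_mult using yy(1,2) by (simp add: algebra_simps)
  ultimately have "\<bar>q * y - l\<bar> + \<bar>q * (1 - y) - r\<bar> \<le> \<bar>q - a\<bar> + 2 * (a * \<delta>)"
    using abs_triangle_ineq[of "(q - a) * y" d] abs_triangle_ineq4[of "(q - a) * (1 - y)" d] by linarith
  then show ?thesis unfolding a_def l_def r_def by (simp add: mult.commute mult.left_commute)
qed

text \<open>\<open>n\<close> splits and one stopping call use up \<open>Suc n\<close> generations;
  any larger budget gives the same mass \<open>v\<close>, so the supremum in
  \<open>dmmt_measure\<close> is attained. Each generation adds an error of
  \<open>2 * \<delta>\<close> times the \<open>F\<close>-mass, and these masses add up over the
  halves. The last conjunct records that no mass is lost, which yields a probability
  measure.\<close>

lemma run_mass_error:
  assumes "A \<in> level_nodes k" "k + n = K" "0 \<le> q" "B \<in> sets Q0"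
  shows "\<exists>v\<ge>0. (\<forall>m. run_mass Q0 t S J Y (Suc n + m) A Divide q B = ennreal v) \<and>
    \<bar>v - averaged (\<lambda>A. measure F (rect_set A)) n k A B\<bar>
      \<le> \<bar>q - measure F (rect_set A)\<bar> + 2 * \<delta> * real n * measure F (rect_set A) \<and>
    (rect_set A \<subseteq> B \<longrightarrow> v = q)"
  using assms(1-3)
proof (induction n arbitrary: k A q)
  case 0
  have A: "A \<in> nodes" using 0(1) level_nodes_subset_nodes by blast
  note p0 = node_pos[OF A] and mA = node_measurable[OF A]
  define p where "p = measure Q0 (rect_set A \<inter> B) / measure Q0 (rect_set A)"
  have p: "0 \<le> p" "p \<le> 1"
    using p0 mA assms(4) by (auto simp: p_def divide_le_eq intro!: finite_measure_mono)
  have "emeasure (uniform_measure Q0 (rect_set A)) B = ennreal p"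
    using p0 mA assms(4) by (simp add: emeasure_eq_measure divide_ennreal p_def)
  then have "run_mass Q0 t S J Y (Suc 0 + m) A Divide q B = ennreal (q * p)" for m
    using stop 0 p by (simp add: Let_def ennreal_mult)
  moreover have "\<bar>q * p - averaged (\<lambda>A. measure F (rect_set A)) 0 k A B\<bar> \<le> \<bar>q - measure F (rect_set A)\<bar>"
  proof -
    have "\<bar>q * p - averaged (\<lambda>A. measure F (rect_set A)) 0 k A B\<bar> = \<bar>q - measure F (rect_set A)\<bar> * p"
      using p(1) by (simp add: p_def[symmetric] left_diff_distrib[symmetric] abs_mult)
    also have "\<dots> \<le> \<bar>q - measure F (rect_set A)\<bar>" by (rule mult_left_le[OF p(2) abs_ge_zero])
    finally show ?thesis .
  qed
  moreover have "rect_set A \<subseteq> B \<Longrightarrow> q * p = q"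
    using p0 by (simp add: p_def Int_absorb2)
  ultimately show ?case using 0(3) p(1) by (intro exI[of _ "q * p"]) simp
next
  case (Suc n)
  let ?L = "left_half (e k) A" and ?R = "right_half (e k) A"
  let ?F = "\<lambda>A. measure F (rect_set A)"
  have k: "k < K" using Suc.prems(2) by simp
  have A: "A \<in> nodes" using Suc.prems(1) level_nodes_subset_nodes by blast
  define y where "y = Y (A, Divide, e k, t)"
  have y: "0 < y" "y < 1" using proportion[OF Suc.prems(1) k] by (auto simp: y_def)
  note halves = half_level_nodes[OF Suc.prems(1), of "e k"]
  have q: "0 \<le> q * y" "0 \<le> q * (1 - y)" using y Suc.prems(3) by simp_all
  have k': "Suc k + n = K" using Suc.prems(2) by simp
  obtain v where v: "0 \<le> v" "\<And>m. run_mass Q0 t S J Y (Suc n + m) ?L Divide (q * y) B = ennreal v"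
      "\<bar>v - averaged ?F n (Suc k) ?L B\<bar> \<le> \<bar>q * y - ?F ?L\<bar> + 2 * \<delta> * real n * ?F ?L"
      "rect_set ?L \<subseteq> B \<longrightarrow> v = q * y"
    using Suc.IH[OF halves(1) k' q(1)] by blast
  obtain w where w: "0 \<le> w" "\<And>m. run_mass Q0 t S J Y (Suc n + m) ?R Divide (q * (1 - y)) B = ennreal w"
      "\<bar>w - averaged ?F n (Suc k) ?R B\<bar> \<le> \<bar>q * (1 - y) - ?F ?R\<bar> + 2 * \<delta> * real n * ?F ?R"
      "rect_set ?R \<subseteq> B \<longrightarrow> w = q * (1 - y)"
    using Suc.IH[OF halves(2) k' q(2)] by blast
  have "run_mass Q0 t S J Y (Suc (Suc n) + m) A Divide q B = ennreal (v + w)" for m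
  proof -
    have "run_mass Q0 t S J Y (Suc (Suc n + m)) A Divide q B =
        run_mass Q0 t S J Y (Suc n + m) ?L Divide (q * y) B +
        run_mass Q0 t S J Y (Suc n + m) ?R Divide (q * (1 - y)) B"
      using divide[OF Suc.prems(1) k] dir[OF Suc.prems(1) k]
      by (subst run_mass.simps(2)) (simp only: Let_def y_def gstate.distinct if_False refl)
    then show ?thesis
      unfolding add_Suc[of "Suc n" m] v(2) w(2) ennreal_plus[OF v(1) w(1)] .
  qed
  moreover have "\<bar>v + w - averaged ?F (Suc n) k A B\<bar>
      \<le> \<bar>q - ?F A\<bar> + 2 * \<delta> * real (Suc n) * ?F A"
  proof -
    have "?F A = ?F ?L + ?F ?R"
      unfolding rect_set_halves[OF A, of "e k"]
      using half_nodes[OF A] by (intro F.finite_measure_Union rect_set_halves_disjoint)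
        (simp_all add: sets_F sets_cube_borel_node)
    then have eq: "2 * \<delta> * real (Suc n) * ?F A =
        2 * \<delta> * ?F A + 2 * \<delta> * real n * ?F ?L + 2 * \<delta> * real n * ?F ?R"
      by (simp add: algebra_simps)
    have "\<bar>v + w - averaged ?F (Suc n) k A B\<bar>
      \<le> \<bar>v - averaged ?F n (Suc k) ?L B\<bar> + \<bar>w - averaged ?F n (Suc k) ?R B\<bar>"
      by simp
    then show ?thesis
      using v(3) w(3) split_error[OF Suc.prems(1) k y_def, of q] unfolding eq by linarith
  qed
  moreover have "rect_set A \<subseteq> B \<Longrightarrow> v + w = q"
    using v(4) w(4) rect_set_halves[OF A, of "e k"] by (auto simp: algebra_simps)
  ultimately show ?case using v(1) w(1) by (intro exI[of _ "v + w"]) auto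
qed

lemma dmmt_measure_error:
  assumes B: "B \<in> sets Q0"
  shows "\<exists>v\<ge>0. emeasure (dmmt_measure Q0 t (h0, S, J, Y)) B = ennreal v \<and>
    \<bar>v - averaged (\<lambda>A. measure F (rect_set A)) K 0 unit_rect B\<bar> \<le> 2 * \<delta> * real K \<and>
    (B = rect_set unit_rect \<longrightarrow> v = 1)"
proof -
  have F1: "measure F (rect_set unit_rect) = 1"
    using F.prob_space sets_eq_imp_space_eq[OF sets_F] by simp
  obtain v where v: "0 \<le> v" "\<And>m. run_mass Q0 t S J Y (Suc K + m) unit_rect Divide 1 B = ennreal v"
      "\<bar>v - averaged (\<lambda>A. measure F (rect_set A)) K 0 unit_rect B\<bar> \<le> 2 * \<delta> * real K"
      "rect_set unit_rect \<subseteq> B \<longrightarrow> v = 1"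
    using run_mass_error[of unit_rect 0 K 1 B] B by (auto simp: F1)
  \<comment> \<open>The parent's state enters a call only through the state drawn for the node, and
    \<open>root\<close> makes that draw agree for \<open>h0\<close> and Divide.\<close>
  have eq: "run_mass Q0 t S J Y (Suc K + m) unit_rect h0 1 B = ennreal v" for m
    using v(2)[of m] root by (simp add: Let_def)
  have "(SUP n. run_mass Q0 t S J Y n unit_rect h0 1 B) = ennreal v"
  proof (rule antisym)
    show "(SUP n. run_mass Q0 t S J Y n unit_rect h0 1 B) \<le> ennreal v"
    proof (rule SUP_least)
      fix n
      have "run_mass Q0 t S J Y n unit_rect h0 1 B \<le> run_mass Q0 t S J Y (Suc K + n) unit_rect h0 1 B"
        by (rule run_mass_mono) simp
      then show "run_mass Q0 t S J Y n unit_rect h0 1 B \<le> ennreal v" by (simp only: eq)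
    qed
    show "ennreal v \<le> (SUP n. run_mass Q0 t S J Y n unit_rect h0 1 B)"
      by (rule SUP_upper2[of "Suc K + 0"]) (simp_all only: eq UNIV_I order_refl)
  qed
  then show ?thesis
    using v B by (intro exI[of _ v]) (simp add: emeasure_dmmt_measure[OF sets_Q0] sets_Q0)
qed

lemma prob_space_dmmt_measure: "prob_space (dmmt_measure Q0 t (h0, S, J, Y))"
proof (rule prob_spaceI)
  have "space (dmmt_measure Q0 t (h0, S, J, Y)) = rect_set unit_rect"
    using sets_eq_imp_space_eq[OF sets_dmmt_measure] by simp
  then show "emeasure (dmmt_measure Q0 t (h0, S, J, Y)) (space (dmmt_measure Q0 t (h0, S, J, Y))) = 1"
    using dmmt_measure_error[OF node_measurable[OF unit_rect_node]] by auto
qed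

lemma rn_dens_dmmt_measure_L1:
  assumes ac: "absolutely_continuous Q0 F"
    and \<eta>: "\<And>B. B \<in> sets Q0 \<Longrightarrow>
      \<bar>averaged (\<lambda>A. measure F (rect_set A)) K 0 unit_rect B - measure F B\<bar> \<le> \<eta>"
  shows "(\<integral>x. \<bar>rn_dens Q0 (dmmt_measure Q0 t (h0, S, J, Y)) x - rn_dens Q0 F x\<bar> \<partial>Q0)
    \<le> 2 * (2 * \<delta> * real K + \<eta>)"
proof -
  let ?Q = "dmmt_measure Q0 t (h0, S, J, Y)"
  have s: "sets ?Q = sets Q0" "sets F = sets Q0" by (simp_all add: sets_dmmt_measure sets_F sets_Q0)
  obtain B where B: "B \<in> sets Q0"
      "(\<integral>x. \<bar>rn_dens Q0 ?Q x - rn_dens Q0 F x\<bar> \<partial>Q0) = 2 * (measure ?Q B - measure F B)"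
    using rn_dens_L1_eq(1)[OF prob_space_axioms prob_space_dmmt_measure s(1)
        absolutely_continuous_dmmt_measure F.prob_space_axioms s(2) ac] by blast
  obtain v where v: "0 \<le> v" "emeasure ?Q B = ennreal v"
      "\<bar>v - averaged (\<lambda>A. measure F (rect_set A)) K 0 unit_rect B\<bar> \<le> 2 * \<delta> * real K"
    using dmmt_measure_error[OF B(1)] by blast
  have "measure ?Q B = v" using v(1,2) by (simp add: measure_def)
  then have "measure ?Q B - measure F B \<le> 2 * \<delta> * real K + \<eta>"
    using v(3) \<eta>[OF B(1)] by argo
  then show ?thesis unfolding B(2) by simp
qed

end

section \<open>The law of the process\<close>

lemma UNIV_gstate: "UNIV = {Divide, Merge, Stop}"
  using gstate.exhaust by auto

lemma countable_UNIV_gstate: "countable (UNIV :: gstate set)"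
  by (simp add: UNIV_gstate)

text \<open>Which draws are read depends on random states and directions, but these take finitely
  many values, so each value can be treated separately. The mass \<open>q\<close> is allowed to be
  random because the recursion passes on products with beta draws.\<close>

lemma measurable_run_mass:
  fixes S :: "'w \<Rightarrow> 'p::finite rect \<times> gstate \<Rightarrow> gstate"
  assumes S: "\<And>A h. A \<in> nodes \<Longrightarrow> (\<lambda>\<omega>. S \<omega> (A, h)) \<in> measurable N (count_space UNIV)"
    and J: "\<And>A g. A \<in> nodes \<Longrightarrow> g \<in> {Divide, Merge} \<Longrightarrow> (\<lambda>\<omega>. J \<omega> (A, g)) \<in> measurable N (count_space UNIV)"
    and Y: "\<And>A g j t. A \<in> nodes \<Longrightarrow> g \<in> {Divide, Merge} \<Longrightarrow> t \<in> {1, 2} \<Longrightarrow>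
      (\<lambda>\<omega>. Y \<omega> (A, g, j, t)) \<in> borel_measurable N"
    and t: "t \<in> {1, 2}" and A: "A \<in> nodes" and q: "q \<in> borel_measurable N"
  shows "(\<lambda>\<omega>. run_mass Q0 t (S \<omega>) (J \<omega>) (Y \<omega>) n A h (q \<omega>) B) \<in> borel_measurable N"
  using A q
proof (induction n arbitrary: A h q)
  case (Suc n)
  note [measurable] = Suc.prems(2)
  define branch where "branch g j \<omega> =
      (let y = Y \<omega> (A, g, j, if g = Merge then 1 else t) in
        run_mass Q0 t (S \<omega>) (J \<omega>) (Y \<omega>) n (left_half j A) g (q \<omega> * y) B +
        run_mass Q0 t (S \<omega>) (J \<omega>) (Y \<omega>) n (right_half j A) g (q \<omega> * (1 - y)) B)" for g j \<omega>
  define step where "step g \<omega> =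
      (if g = Stop then ennreal (q \<omega>) * emeasure (uniform_measure Q0 (rect_set A)) B
       else branch g (J \<omega> (A, g)) \<omega>)" for g \<omega>
  have branch: "branch g j \<in> borel_measurable N" if g: "g \<noteq> Stop" for g j
  proof -
    have g': "g \<in> {Divide, Merge}" using g by (cases g) auto
    have [measurable]: "(\<lambda>\<omega>. Y \<omega> (A, g, j, if g = Merge then 1 else t)) \<in> borel_measurable N"
      using t by (intro Y Suc.prems(1) g') auto
    show ?thesis
      unfolding branch_def[abs_def] Let_def
      by (intro borel_measurable_add Suc.IH half_nodes Suc.prems(1)) measurable
  qed
  have "step g \<in> borel_measurable N" for g
  proof (cases "g = Stop")
    case True
    then show ?thesis unfolding step_def[abs_def] by simp
  next
    case False
    then have g': "g \<in> {Divide, Merge}" by (cases g) auto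
    have "(\<lambda>\<omega>. branch g (J \<omega> (A, g)) \<omega>) \<in> borel_measurable N"
      by (rule measurable_compose_countable'[where I = UNIV, OF branch[OF False] J[OF Suc.prems(1) g']])
        (simp add: countable_finite)
    then show ?thesis using False unfolding step_def[abs_def] by simp
  qed
  then have meas: "(\<lambda>\<omega>. step (S \<omega> (A, h)) \<omega>) \<in> borel_measurable N"
    by (rule measurable_compose_countable'[where I = UNIV, OF _ S[OF Suc.prems(1)] countable_UNIV_gstate])
  have "run_mass Q0 t (S \<omega>) (J \<omega>) (Y \<omega>) (Suc n) A h (q \<omega>) B = step (S \<omega> (A, h)) \<omega>" for \<omega>
    by (cases "S \<omega> (A, h) = Stop") (simp_all add: step_def branch_def Let_def)
  with meas show ?case by (simp only:)
qed simp

section \<open>Positive probability of conditions on finitely many draws\<close>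

lemma prob_space_beta_measure:
  assumes "0 < fst ab" "0 < snd ab"
  shows "prob_space (beta_measure ab)"
proof (rule prob_spaceI)
  let ?a = "fst ab" and ?b = "snd ab"
  have Bpos: "0 < Beta ?a ?b"
    using assms by (simp add: Beta_def Gamma_real_pos)
  have "((\<lambda>y. y powr (?a - 1) * (1 - y) powr (?b - 1)) has_integral Beta ?a ?b) {0<..<1}"
    using has_integral_Beta_real[OF assms] has_integral_Icc_iff_Ioo by blast
  then have "((\<lambda>y. y powr (?a - 1) * (1 - y) powr (?b - 1) / Beta ?a ?b) has_integral (Beta ?a ?b / Beta ?a ?b)) {0<..<1}"
    by (rule has_integral_divide)
  then have "((\<lambda>y. indicator {0<..<1} y * y powr (?a - 1) * (1 - y) powr (?b - 1) / Beta ?a ?b) has_integral 1) UNIV"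
    using Bpos by (subst (asm) has_integral_restrict_UNIV[symmetric])
      (auto elim!: has_integral_eq[rotated])
  then have "(\<integral>\<^sup>+y. ennreal (indicator {0<..<1} y * y powr (?a - 1) * (1 - y) powr (?b - 1) / Beta ?a ?b) \<partial>lborel) = ennreal 1"
    using Bpos by (intro nn_integral_has_integral_lborel) auto
  then show "emeasure (beta_measure ab) (space (beta_measure ab)) = 1"
    by (simp add: beta_measure_def emeasure_density)
qed

lemma sets_beta_measure [measurable_cong]: "sets (beta_measure ab) = sets borel"
  by (simp add: beta_measure_def)

text \<open>The density is positive on the open unit interval, and the window around
  \<open>c\<close> meets it in a nonempty interval even when \<open>c\<close> is 0 or 1.\<close>

lemma beta_measure_pos:
  assumes "0 < fst ab" "0 < snd ab" "0 \<le> c" "c \<le> 1" "0 < \<delta>"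
  shows "0 < emeasure (beta_measure ab) {y. 0 < y \<and> y < 1 \<and> \<bar>y - c\<bar> < \<delta>}"
proof -
  let ?I = "{max 0 (c - \<delta>)<..<min 1 (c + \<delta>)}"
  let ?d = "\<lambda>y. ennreal (indicator {0<..<1} y * y powr (fst ab - 1) * (1 - y) powr (snd ab - 1) / Beta (fst ab) (snd ab))"
  have eq: "{y. 0 < y \<and> y < 1 \<and> \<bar>y - c\<bar> < \<delta>} = ?I" by auto
  have Bpos: "0 < Beta (fst ab) (snd ab)"
    using assms by (simp add: Beta_def Gamma_real_pos)
  have d_pos: "0 < ?d y" if "y \<in> ?I" for y
    using that Bpos by (auto simp: indicator_def)
  have "emeasure (beta_measure ab) ?I \<noteq> 0"
  proof
    assume "emeasure (beta_measure ab) ?I = 0"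
    then have "(\<integral>\<^sup>+y. ?d y * indicator ?I y \<partial>lborel) = 0"
      unfolding beta_measure_def by (subst (asm) emeasure_density) auto
    then have "AE y in lborel. ?d y * indicator ?I y = 0"
      by (subst (asm) nn_integral_0_iff_AE) auto
    then have "AE y in lborel. y \<notin> ?I"
    proof eventually_elim
      case (elim y)
      then show ?case using d_pos[of y] by (cases "y \<in> ?I") auto
    qed
    then have "emeasure lborel ?I = 0"
      by (subst (asm) AE_iff_measurable[of ?I]) auto
    then show False using assms(3-5) by (simp add: emeasure_lborel_Ioo split: if_splits)
  qed
  then show ?thesis unfolding eq by (simp add: zero_less_iff_neq_zero)
qed

lemma emeasure_PiM_Collect_pos:
  assumes M: "\<And>i. i \<in> I \<Longrightarrow> prob_space (M i)"
    and J: "J \<subseteq> I" "finite J" and X: "\<And>i. i \<in> J \<Longrightarrow> X i \<in> sets (M i)" "\<And>i. i \<in> J \<Longrightarrow> 0 < emeasure (M i) (X i)"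
  shows "{x \<in> space (PiM I M). \<forall>i\<in>J. x i \<in> X i} \<in> sets (PiM I M)"
    and "0 < emeasure (PiM I M) {x \<in> space (PiM I M). \<forall>i\<in>J. x i \<in> X i}"
proof -
  have eq: "{x \<in> space (PiM I M). \<forall>i\<in>J. x i \<in> X i} = prod_emb I M J (Pi\<^sub>E J X)"
    unfolding prod_emb_def using J(1) by (auto simp: space_PiM Pi_iff)
  show "{x \<in> space (PiM I M). \<forall>i\<in>J. x i \<in> X i} \<in> sets (PiM I M)"
    unfolding eq by (rule sets_PiM_I[OF J(2,1)]) (use X(1) in blast)
  have "emeasure (PiM I M) {x \<in> space (PiM I M). \<forall>i\<in>J. x i \<in> X i} = (\<Prod>i\<in>J. emeasure (M i) (X i))"
    unfolding eq by (rule emeasure_PiM_emb[OF M J X(1)])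
  also have "\<dots> \<noteq> 0"
    unfolding prod_zero_iff[OF J(2)] using X(2) by (auto simp: zero_less_iff_neq_zero)
  finally show "0 < emeasure (PiM I M) {x \<in> space (PiM I M). \<forall>i\<in>J. x i \<in> X i}"
    by (simp add: zero_less_iff_neq_zero)
qed

lemma emeasure_pair_Times_pos:
  assumes "prob_space N" "A \<in> sets M" "B \<in> sets N" "0 < emeasure M A" "0 < emeasure N B"
  shows "A \<times> B \<in> sets (M \<Otimes>\<^sub>M N)" "0 < emeasure (M \<Otimes>\<^sub>M N) (A \<times> B)"
proof -
  interpret N: prob_space N by fact
  show "A \<times> B \<in> sets (M \<Otimes>\<^sub>M N)" using assms by simp
  show "0 < emeasure (M \<Otimes>\<^sub>M N) (A \<times> B)"
    using assms by (simp add: N.emeasure_pair_measure_Times ennreal_zero_less_mult_iff)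
qed

section \<open>Measurability of the random pair of measures\<close>

lemma measurable_dmmt_measure:
  fixes \<rho> :: "'p::finite rect \<Rightarrow> gstate \<Rightarrow> gstate pmf"
  assumes Q0: "Q0 \<in> space (prob_algebra cube_borel)" and t: "t \<in> {1, 2}" and B: "B \<in> sets cube_borel"
  shows "(\<lambda>\<omega>. emeasure (dmmt_measure Q0 t \<omega>) B) \<in> borel_measurable (dmmt_draws \<rho>0 \<rho> \<alpha> \<Lambda>)"
proof -
  let ?N = "dmmt_draws \<rho>0 \<rho> \<alpha> \<Lambda>"
  have sQ0: "sets Q0 = sets cube_borel" using Q0 by (simp add: space_prob_algebra)
  have h0: "(\<lambda>\<omega>. fst \<omega>) \<in> measurable ?N (count_space UNIV)"
  proof -
    have "fst \<in> measurable ?N (measure_pmf \<rho>0)" unfolding dmmt_draws_def by measurable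
    then show ?thesis by simp
  qed
  have S: "(\<lambda>\<omega>. fst (snd \<omega>) (A, h)) \<in> measurable ?N (count_space UNIV)" if "A \<in> nodes" for A h
  proof -
    have "(\<lambda>\<omega>. fst (snd \<omega>)) \<in> measurable ?N
        (\<Pi>\<^sub>M (A, h) \<in> nodes \<times> UNIV. measure_pmf (\<rho> A h))"
      unfolding dmmt_draws_def by measurable
    from measurable_compose[OF this measurable_component_singleton[of "(A, h)"]] that
    have "(\<lambda>\<omega>. fst (snd \<omega>) (A, h)) \<in> measurable ?N (measure_pmf (\<rho> A h))" by simp
    then show ?thesis by simp
  qed
  have J: "(\<lambda>\<omega>. fst (snd (snd \<omega>)) (A, g)) \<in> measurable ?N (count_space UNIV)"
    if "A \<in> nodes" "g \<in> {Divide, Merge}" for A g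
  proof -
    have "(\<lambda>\<omega>. fst (snd (snd \<omega>))) \<in> measurable ?N
        (\<Pi>\<^sub>M (A, g) \<in> nodes \<times> {Divide, Merge}. measure_pmf (\<Lambda> A g))"
      unfolding dmmt_draws_def by measurable
    from measurable_compose[OF this measurable_component_singleton[of "(A, g)"]] that
    have "(\<lambda>\<omega>. fst (snd (snd \<omega>)) (A, g)) \<in> measurable ?N (measure_pmf (\<Lambda> A g))" by simp
    then show ?thesis by simp
  qed
  have Y: "(\<lambda>\<omega>. snd (snd (snd \<omega>)) (A, g, j, t)) \<in> borel_measurable ?N"
    if "A \<in> nodes" "g \<in> {Divide, Merge}" "t \<in> {1, 2}" for A g j t
  proof -
    have "(\<lambda>\<omega>. snd (snd (snd \<omega>))) \<in> measurable ?N
        (\<Pi>\<^sub>M (A, g, j, t) \<in> nodes \<times> {Divide, Merge} \<times> UNIV \<times> {1, 2}. beta_measure (\<alpha> A g j t))"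
      unfolding dmmt_draws_def by measurable
    from measurable_compose[OF this measurable_component_singleton[of "(A, g, j, t)"]] that
    have "(\<lambda>\<omega>. snd (snd (snd \<omega>)) (A, g, j, t)) \<in> measurable ?N (beta_measure (\<alpha> A g j t))" by simp
    then show ?thesis by (simp add: measurable_cong_sets[OF refl sets_beta_measure])
  qed
  have run: "(\<lambda>\<omega>. run_mass Q0 t (fst (snd \<omega>)) (fst (snd (snd \<omega>))) (snd (snd (snd \<omega>))) n unit_rect h 1 B)
      \<in> borel_measurable ?N" for n h
    by (rule measurable_run_mass[where S = "\<lambda>\<omega>. fst (snd \<omega>)" and J = "\<lambda>\<omega>. fst (snd (snd \<omega>))"
          and Y = "\<lambda>\<omega>. snd (snd (snd \<omega>))"]) (use S J Y t unit_rect_node in auto)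
  have "(\<lambda>\<omega>. run_mass Q0 t (fst (snd \<omega>)) (fst (snd (snd \<omega>))) (snd (snd (snd \<omega>))) n unit_rect (fst \<omega>) 1 B)
      \<in> borel_measurable ?N" for n
    by (rule measurable_compose_countable'[where I = UNIV, OF run h0 countable_UNIV_gstate])
  then have "(\<lambda>\<omega>. SUP n. run_mass Q0 t (fst (snd \<omega>)) (fst (snd (snd \<omega>))) (snd (snd (snd \<omega>))) n unit_rect (fst \<omega>) 1 B)
      \<in> borel_measurable ?N"
    by (intro borel_measurable_SUP) auto
  moreover have "emeasure (dmmt_measure Q0 t \<omega>) B =
      (SUP n. run_mass Q0 t (fst (snd \<omega>)) (fst (snd (snd \<omega>))) (snd (snd (snd \<omega>))) n unit_rect (fst \<omega>) 1 B)" for \<omega>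
    using emeasure_dmmt_measure[OF sQ0 B, of t "fst \<omega>" "fst (snd \<omega>)" "fst (snd (snd \<omega>))" "snd (snd (snd \<omega>))"]
    by (simp only: prod.collapse)
  ultimately show ?thesis by (simp only:)
qed

lemma prob_space_dmmt_measure_iff:
  "prob_space (dmmt_measure Q0 t \<omega>) \<longleftrightarrow> emeasure (dmmt_measure Q0 t \<omega>) (rect_set unit_rect) = 1"
proof -
  have "space (dmmt_measure Q0 t \<omega>) = rect_set unit_rect"
    using sets_eq_imp_space_eq[OF sets_dmmt_measure] by simp
  then show ?thesis
    using prob_spaceI[of "dmmt_measure Q0 t \<omega>"] prob_space.emeasure_space_1[of "dmmt_measure Q0 t \<omega>"] by metis
qed

text \<open>Needed before probabilities under \<open>DMMT\<close> can be computed as preimages.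
  Being a probability measure reduces to one evaluation, and moving the case distinction into the
  components makes each of them a probability measure for every draw.\<close>

lemma measurable_dmmt_pair:
  fixes \<rho> :: "'p::finite rect \<Rightarrow> gstate \<Rightarrow> gstate pmf"
  assumes Q0: "Q0 \<in> space (prob_algebra cube_borel)"
  shows "(\<lambda>\<omega>. if prob_space (dmmt_measure Q0 1 \<omega>) \<and> prob_space (dmmt_measure Q0 2 \<omega>)
            then (dmmt_measure Q0 1 \<omega>, dmmt_measure Q0 2 \<omega>) else (Q0, Q0))
    \<in> measurable (dmmt_draws \<rho>0 \<rho> \<alpha> \<Lambda>) (prob_algebra cube_borel \<Otimes>\<^sub>M prob_algebra cube_borel)"
proof -
  let ?N = "dmmt_draws \<rho>0 \<rho> \<alpha> \<Lambda>"
  let ?P = "\<lambda>\<omega>. prob_space (dmmt_measure Q0 1 \<omega>) \<and> prob_space (dmmt_measure Q0 2 \<omega>)"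
  have P0: "prob_space Q0" and s0: "sets Q0 = sets cube_borel" using Q0 by (auto simp: space_prob_algebra)
  have "(\<lambda>\<omega>. emeasure (dmmt_measure Q0 t \<omega>) (rect_set unit_rect)) \<in> borel_measurable ?N"
    if "t \<in> {1, 2}" for t
    using measurable_dmmt_measure[OF Q0 that sets_cube_borel_node[OF unit_rect_node]] .
  from this[of 1] this[of 2]
  have [measurable]: "(\<lambda>\<omega>. emeasure (dmmt_measure Q0 1 \<omega>) (rect_set unit_rect)) \<in> borel_measurable ?N"
      "(\<lambda>\<omega>. emeasure (dmmt_measure Q0 2 \<omega>) (rect_set unit_rect)) \<in> borel_measurable ?N"
    by simp_all
  have [measurable]: "Measurable.pred ?N ?P"
    unfolding prob_space_dmmt_measure_iff by measurable
  have "(\<lambda>\<omega>. if ?P \<omega> then dmmt_measure Q0 t \<omega> else Q0) \<in> measurable ?N (prob_algebra cube_borel)"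
    if t: "t \<in> {1, 2}" for t
  proof (rule measurable_prob_algebraI)
    show *: "prob_space (if ?P \<omega> then dmmt_measure Q0 t \<omega> else Q0)" for \<omega>
      using t P0 by auto
    show "(\<lambda>\<omega>. if ?P \<omega> then dmmt_measure Q0 t \<omega> else Q0) \<in> measurable ?N (subprob_algebra cube_borel)"
    proof (rule measurable_subprob_algebra)
      show "subprob_space (if ?P \<omega> then dmmt_measure Q0 t \<omega> else Q0)" for \<omega>
        by (rule prob_space_imp_subprob_space[OF *])
      show "sets (if ?P \<omega> then dmmt_measure Q0 t \<omega> else Q0) = sets cube_borel" for \<omega>
        by (simp add: sets_dmmt_measure s0)
      fix B :: "(real ^ 'p) set" assume "B \<in> sets cube_borel"
      then have [measurable]: "(\<lambda>\<omega>. emeasure (dmmt_measure Q0 t \<omega>) B) \<in> borel_measurable ?N"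
        by (rule measurable_dmmt_measure[OF Q0 t])
      have "(\<lambda>\<omega>. if ?P \<omega> then emeasure (dmmt_measure Q0 t \<omega>) B else emeasure Q0 B) \<in> borel_measurable ?N"
        by measurable
      then show "(\<lambda>\<omega>. emeasure (if ?P \<omega> then dmmt_measure Q0 t \<omega> else Q0) B) \<in> borel_measurable ?N"
        by (simp only: if_distrib[of "\<lambda>M. emeasure M B"])
    qed
  qed
  note comp = this
  have pair: "(\<lambda>\<omega>. if ?P \<omega> then (dmmt_measure Q0 1 \<omega>, dmmt_measure Q0 2 \<omega>) else (Q0, Q0)) =
      (\<lambda>\<omega>. (if ?P \<omega> then dmmt_measure Q0 1 \<omega> else Q0, if ?P \<omega> then dmmt_measure Q0 2 \<omega> else Q0))"
    by (rule ext) simp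
  show ?thesis
    unfolding pair by (rule measurable_Pair[OF comp comp]) simp_all
qed

section \<open>Full support\<close>

text \<open>Independence turns finitely many conditions of positive probability into one event of
  positive probability. The event is described pointwise so that the nested product structure stays
  inside this proof.\<close>

lemma dmmt_draws_cylinder_pos:
  fixes \<rho> :: "'p::finite rect \<Rightarrow> gstate \<Rightarrow> gstate pmf"
  assumes counts: "\<And>A g j t. A \<in> nodes \<Longrightarrow> g \<in> {Divide, Merge} \<Longrightarrow> t \<in> {1, 2} \<Longrightarrow>
      0 < fst (\<alpha> A g j t) \<and> 0 < snd (\<alpha> A g j t)"
    and h0: "0 < pmf \<rho>0 h0"
    and IS: "IS \<subseteq> nodes \<times> UNIV" "finite IS" "\<And>A h. (A, h) \<in> IS \<Longrightarrow> 0 < pmf (\<rho> A h) (s (A, h))"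
    and IJ: "IJ \<subseteq> nodes \<times> {Divide, Merge}" "finite IJ" "\<And>A g. (A, g) \<in> IJ \<Longrightarrow> 0 < pmf (\<Lambda> A g) (d (A, g))"
    and IY: "IY \<subseteq> nodes \<times> {Divide, Merge} \<times> UNIV \<times> {1, 2}" "finite IY"
      "\<And>i. i \<in> IY \<Longrightarrow> X i \<in> sets borel"
      "\<And>A g j t. (A, g, j, t) \<in> IY \<Longrightarrow> 0 < emeasure (beta_measure (\<alpha> A g j t)) (X (A, g, j, t))"
  shows "\<exists>G\<in>sets (dmmt_draws \<rho>0 \<rho> \<alpha> \<Lambda>). 0 < emeasure (dmmt_draws \<rho>0 \<rho> \<alpha> \<Lambda>) G \<and>
    (\<forall>h S J Y. (h, S, J, Y) \<in> G \<longrightarrow>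
      h = h0 \<and> (\<forall>i\<in>IS. S i = s i) \<and> (\<forall>i\<in>IJ. J i = d i) \<and> (\<forall>i\<in>IY. Y i \<in> X i))"
proof -
  define PS where "PS = (\<lambda>(A, h). measure_pmf (\<rho> A h))"
  define PJ where "PJ = (\<lambda>(A, g). measure_pmf (\<Lambda> A g))"
  define PY where "PY = (\<lambda>(A, g, j, t). beta_measure (\<alpha> A g j t))"
  let ?NS = "PiM (nodes \<times> UNIV) PS" and ?NJ = "PiM (nodes \<times> {Divide, Merge}) PJ"
    and ?NY = "PiM (nodes \<times> {Divide, Merge} \<times> UNIV \<times> {1, 2}) PY"
  have N: "dmmt_draws \<rho>0 \<rho> \<alpha> \<Lambda> = measure_pmf \<rho>0 \<Otimes>\<^sub>M ?NS \<Otimes>\<^sub>M ?NJ \<Otimes>\<^sub>M ?NY"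
    by (simp add: dmmt_draws_def PS_def PJ_def PY_def)
  have pS: "prob_space (PS i)" for i by (cases i) (simp add: PS_def measure_pmf.prob_space_axioms)
  have pJ: "prob_space (PJ i)" for i by (cases i) (simp add: PJ_def measure_pmf.prob_space_axioms)
  have pY: "prob_space (PY i)" if "i \<in> nodes \<times> {Divide, Merge} \<times> UNIV \<times> {1, 2}" for i
    using that counts by (auto simp: PY_def intro!: prob_space_beta_measure)
  have sPY: "sets (PY i) = sets borel" for i
    by (cases i) (simp add: PY_def sets_beta_measure)
  define GS where "GS = {x \<in> space ?NS. \<forall>i\<in>IS. x i \<in> {s i}}"
  define GJ where "GJ = {x \<in> space ?NJ. \<forall>i\<in>IJ. x i \<in> {d i}}"
  define GY where "GY = {x \<in> space ?NY. \<forall>i\<in>IY. x i \<in> X i}"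
  have XS: "{s i} \<in> sets (PS i)" "0 < emeasure (PS i) {s i}" if "i \<in> IS" for i
    using IS(3) that by (cases i; simp add: PS_def emeasure_pmf_single)+
  have S: "GS \<in> sets ?NS" "0 < emeasure ?NS GS"
    unfolding GS_def by (rule emeasure_PiM_Collect_pos[OF pS IS(1,2) XS]; assumption)+
  have XJ: "{d i} \<in> sets (PJ i)" "0 < emeasure (PJ i) {d i}" if "i \<in> IJ" for i
    using IJ(3) that by (cases i; simp add: PJ_def emeasure_pmf_single)+
  have J: "GJ \<in> sets ?NJ" "0 < emeasure ?NJ GJ"
    unfolding GJ_def by (rule emeasure_PiM_Collect_pos[OF pJ IJ(1,2) XJ]; assumption)+
  have XY: "X i \<in> sets (PY i)" "0 < emeasure (PY i) (X i)" if "i \<in> IY" for i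
    using IY(3,4) that unfolding sPY by (cases i; simp add: PY_def)+
  have Y: "GY \<in> sets ?NY" "0 < emeasure ?NY GY"
    unfolding GY_def by (rule emeasure_PiM_Collect_pos[OF pY IY(1,2) XY]; assumption)+
  have qJ: "prob_space ?NJ" by (rule prob_space_PiM[OF pJ])
  have qY: "prob_space ?NY" by (rule prob_space_PiM[OF pY])
  have qS: "prob_space ?NS" by (rule prob_space_PiM[OF pS])
  note JY = emeasure_pair_Times_pos[OF qY J(1) Y(1) J(2) Y(2)]
  note qJY = prob_space_pair[OF qJ qY]
  note SJY = emeasure_pair_Times_pos[OF qJY S(1) JY(1) S(2) JY(2)]
  note qSJY = prob_space_pair[OF qS qJY]
  have "{h0} \<in> sets (measure_pmf \<rho>0)" "0 < emeasure (measure_pmf \<rho>0) {h0}"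
    using h0 by (simp_all add: emeasure_pmf_single)
  note G = emeasure_pair_Times_pos[OF qSJY this(1) SJY(1) this(2) SJY(2)]
  show ?thesis
    unfolding N
  proof (intro bexI[OF _ G(1)] conjI G(2) allI impI)
    fix h S J Y assume "(h, S, J, Y) \<in> {h0} \<times> GS \<times> GJ \<times> GY"
    then show "h = h0" "\<forall>i\<in>IS. S i = s i" "\<forall>i\<in>IJ. J i = d i" "\<forall>i\<in>IY. Y i \<in> X i"
      by (auto simp: GS_def GJ_def GY_def)
  qed
qed

lemma unif_away_01_pos: "unif_away_01 X \<Longrightarrow> x \<in> X \<Longrightarrow> 0 < x"
  unfolding unif_away_01_def by force

text \<open>In dimension one the direction is forced, so its probability is 1 and cannot be bounded
  away from 1; this replaces \<open>dir_away\<close> there.\<close>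

lemma pmf_card_one:
  fixes p :: "'a::finite pmf"
  assumes "CARD('a) = 1"
  shows "pmf p j = 1"
proof -
  have "(UNIV :: 'a set) = {j}" using assms by (metis UNIV_I card_1_singletonE singletonD)
  then have "sum (pmf p) {j} = 1" by (intro sum_pmf_eq_1) auto
  then show ?thesis by simp
qed

text \<open>\<open>trans_away\<close> leaves the transition from Merge to Divide free to be 0.
  \<open>root_divide\<close> excludes the case where the root almost surely does not divide: the
  samples would then agree on both halves of the root and could not approach different targets.
  \<open>Q0_nodes\<close> makes every conditional measure on a node meaningful.\<close>

theorem theorem1:
  fixes \<rho>0 :: "gstate pmf"
    and \<rho> :: "'p::finite rect \<Rightarrow> gstate \<Rightarrow> gstate pmf"
    and \<alpha> :: "'p rect \<Rightarrow> gstate \<Rightarrow> 'p \<Rightarrow> nat \<Rightarrow> real \<times> real"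
    and \<Lambda> :: "'p rect \<Rightarrow> gstate \<Rightarrow> 'p pmf"
    and Q0 F1 F2 :: "(real ^ 'p) measure"
    and M :: "'w measure" and Q1 Q2 :: "'w \<Rightarrow> (real ^ 'p) measure"
    and \<tau> :: real
  assumes Q0: "Q0 \<in> space (prob_algebra cube_borel)"
    and Q0_nodes: "\<And>A. A \<in> nodes \<Longrightarrow> 0 < measure Q0 (rect_set A)"
    and absorbing: "\<And>A. A \<in> nodes \<Longrightarrow> pmf (\<rho> A Stop) Stop = 1"
    and pseudo_counts: "\<And>A g j t. A \<in> nodes \<Longrightarrow> g \<in> {Divide, Merge} \<Longrightarrow> t \<in> {1, 2} \<Longrightarrow>
          0 < fst (\<alpha> A g j t) \<and> 0 < snd (\<alpha> A g j t)"
    and merged_counts: "\<And>A j. A \<in> nodes \<Longrightarrow> \<alpha> A Merge j 1 = \<alpha> A Merge j 2"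
    and M: "prob_space M"
    and Q_rv: "(\<lambda>\<omega>. (Q1 \<omega>, Q2 \<omega>)) \<in>
          measurable M (prob_algebra cube_borel \<Otimes>\<^sub>M prob_algebra cube_borel)"
    and Q_law: "distr M (prob_algebra cube_borel \<Otimes>\<^sub>M prob_algebra cube_borel)
          (\<lambda>\<omega>. (Q1 \<omega>, Q2 \<omega>)) = DMMT \<rho>0 \<rho> \<alpha> \<Lambda> Q0"
    and init_stop: "pmf \<rho>0 Stop < 1"
    and root_divide: "0 < pmf \<rho>0 Divide \<or> 0 < pmf (\<rho> unit_rect Merge) Divide"
    and trans_away: "\<And>h g. (h, g) \<in> {(Divide, Divide), (Divide, Merge), (Divide, Stop),
            (Merge, Merge), (Merge, Stop)} \<Longrightarrow>
          unif_away_01 {pmf (\<rho> A h) g | A. A \<in> nodes}"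
    and dir_away: "CARD('p) \<noteq> 1 \<Longrightarrow>
          unif_away_01 {pmf (\<Lambda> A g) j | A g j. A \<in> nodes \<and> g \<in> {Divide, Merge}}"
    and ratio_away: "unif_away_01 {fst (\<alpha> A g j t) / (fst (\<alpha> A g j t) + snd (\<alpha> A g j t))
            | A g j t. A \<in> nodes \<and> g \<in> {Divide, Merge} \<and> t \<in> {1, 2}}"
    and F1: "F1 \<in> space (prob_algebra cube_borel)" "absolutely_continuous Q0 F1"
    and F2: "F2 \<in> space (prob_algebra cube_borel)" "absolutely_continuous Q0 F2"
    and \<tau>: "0 < \<tau>"
  shows "measure M {\<omega> \<in> space M.
           absolutely_continuous Q0 (Q1 \<omega>) \<and> absolutely_continuous Q0 (Q2 \<omega>) \<and>
           (\<integral>x. \<bar>rn_dens Q0 (Q1 \<omega>) x - rn_dens Q0 F1 x\<bar> \<partial>Q0) < \<tau> \<and>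
           (\<integral>x. \<bar>rn_dens Q0 (Q2 \<omega>) x - rn_dens Q0 F2 x\<bar> \<partial>Q0) < \<tau>} > 0"
proof -
  let ?C = "cube_borel :: (real ^ 'p) measure"
  let ?D = "dmmt_draws \<rho>0 \<rho> \<alpha> \<Lambda>"
  obtain e :: "nat \<Rightarrow> 'p" where e: "recurrent e" using recurrent_exists by blast
  have sQ0: "sets Q0 = sets ?C" and pQ0: "prob_space Q0" using Q0 by (auto simp: space_prob_algebra)
  have sF: "sets F1 = sets ?C" "sets F2 = sets ?C" and pF: "prob_space F1" "prob_space F2"
    using F1 F2 by (auto simp: space_prob_algebra)
  interpret base: dyadic_base Q0 e
    by (intro dyadic_base.intro dyadic_base_axioms.intro pQ0 sQ0 Q0_nodes e)
  interpret M: prob_space M by (rule M)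

  define \<eta> where "\<eta> = \<tau> / 8"
  have \<eta>: "0 < \<eta>" using \<tau> by (simp add: \<eta>_def)
  obtain N1 N2 where
    N1: "\<And>n B. n \<ge> N1 \<Longrightarrow> B \<in> sets Q0 \<Longrightarrow>
      \<bar>base.averaged (\<lambda>A. measure F1 (rect_set A)) n 0 unit_rect B - measure F1 B\<bar> \<le> \<eta>" and
    N2: "\<And>n B. n \<ge> N2 \<Longrightarrow> B \<in> sets Q0 \<Longrightarrow>
      \<bar>base.averaged (\<lambda>A. measure F2 (rect_set A)) n 0 unit_rect B - measure F2 B\<bar> \<le> \<eta>"
    using base.averaged_tendsto[OF pF(1) _ F1(2) \<eta>] base.averaged_tendsto[OF pF(2) _ F2(2) \<eta>]
    unfolding sF sQ0 by meson
  \<comment> \<open>The successor makes \<open>K\<close> positive: the root must be divided, not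
    stopped, and \<open>\<delta>\<close> has \<open>K\<close> in its denominator. With these
    constants the final L1 bound is half of \<open>\<tau>\<close>.\<close>
  define K where "K = Suc (max N1 N2)"
  define \<delta> where "\<delta> = \<tau> / (16 * real K)"
  have \<delta>: "0 < \<delta>" using \<tau> by (simp add: \<delta>_def K_def)
  have bound: "2 * (2 * \<delta> * real K + \<eta>) < \<tau>"
  proof -
    have "real K \<noteq> 0" by (simp add: K_def)
    then have "\<delta> * real K = \<tau> / 16" by (simp add: \<delta>_def)
    then show ?thesis using \<tau> by (simp add: \<eta>_def mult.assoc)
  qed

  have divide_pos: "0 < pmf (\<rho> A Divide) g" if A: "A \<in> nodes" and g: "g \<in> {Divide, Stop}" for A g
  proof -
    have "unif_away_01 {pmf (\<rho> A Divide) g | A. A \<in> nodes}" by (rule trans_away) (use g in auto)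
    moreover have "pmf (\<rho> A Divide) g \<in> {pmf (\<rho> A Divide) g | A. A \<in> nodes}" using A by blast
    ultimately show ?thesis by (rule unif_away_01_pos)
  qed

  \<comment> \<open>A possible state of the fictitious parent from which the root can divide. If
    Divide has initial probability 0, then \<open>init_stop\<close> leaves mass on Merge and
    \<open>root_divide\<close> gives the transition.\<close>
  obtain h0 where h0: "0 < pmf \<rho>0 h0" "0 < pmf (\<rho> unit_rect h0) Divide"
  proof (cases "0 < pmf \<rho>0 Divide")
    case True
    moreover have "0 < pmf (\<rho> unit_rect Divide) Divide"
      by (rule divide_pos[OF unit_rect_node]) simp
    ultimately show ?thesis by (rule that)
  next
    case False
    then have "pmf \<rho>0 Divide = 0" using pmf_nonneg[of \<rho>0 Divide] by linarith
    moreover have "(\<Sum>g\<in>{Divide, Merge, Stop}. pmf \<rho>0 g) = 1"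
      by (rule sum_pmf_eq_1[OF _ subset_UNIV[of "set_pmf \<rho>0", unfolded UNIV_gstate]]) (intro finite.intros)
    ultimately have "0 < pmf \<rho>0 Merge" using init_stop by simp
    then show ?thesis using False root_divide by (intro that[of Merge]) auto
  qed

  define F where "F t = (if t = (1::nat) then F1 else F2)" for t
  \<comment> \<open>States are prescribed up to level \<open>K\<close> inclusive, because level
    \<open>K\<close> must stop; directions and proportions only below \<open>K\<close>, where splits
    occur.\<close>
  define LS where "LS = (\<Union>k\<in>{..K}. level_nodes k :: 'p rect set)"
  define LJ where "LJ = (\<Union>k\<in>{..<K}. level_nodes k :: 'p rect set)"
  define s where "s = (\<lambda>(A :: 'p rect, h :: gstate). if node_level A < K then Divide else Stop)"
  define d where "d = (\<lambda>(A :: 'p rect, g :: gstate). e (node_level A))"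
  define X where "X = (\<lambda>(A :: 'p rect, g :: gstate, j, t). {y. 0 < y \<and> y < 1 \<and>
    \<bar>y - measure (F t) (rect_set (left_half j A)) / measure (F t) (rect_set A)\<bar> < \<delta>})"
  have nodes: "LS \<subseteq> nodes" "LJ \<subseteq> nodes" "finite LS" "finite LJ"
    using level_nodes_subset_nodes by (auto simp: LS_def LJ_def finite_level_nodes)
  have K0: "0 < K" and K_ge: "N1 \<le> K" "N2 \<le> K" by (simp_all add: K_def)
  have "\<exists>G\<in>sets ?D. 0 < emeasure ?D G \<and> (\<forall>h S J Y. (h, S, J, Y) \<in> G \<longrightarrow>
      h = h0 \<and> (\<forall>i\<in>insert (unit_rect, h0) (LS \<times> {Divide}). S i = s i) \<and>
      (\<forall>i\<in>LJ \<times> {Divide}. J i = d i) \<and> (\<forall>i\<in>LJ \<times> {Divide} \<times> UNIV \<times> {1, 2}. Y i \<in> X i))"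
  proof (rule dmmt_draws_cylinder_pos[OF pseudo_counts h0(1)])
    show "insert (unit_rect, h0) (LS \<times> {Divide}) \<subseteq> nodes \<times> UNIV"
      using nodes(1) unit_rect_node by blast
    show "0 < pmf (\<rho> A h) (s (A, h))" if i: "(A, h) \<in> insert (unit_rect, h0) (LS \<times> {Divide})" for A h
    proof (cases "(A, h) = (unit_rect, h0)")
      case True
      then show ?thesis using h0(2) K0 node_level_eq[of "unit_rect :: 'p rect" 0] by (simp add: s_def)
    next
      case False
      then have A: "A \<in> nodes" "h = Divide" using i nodes(1) by auto
      have "0 < pmf (\<rho> A Divide) Divide" "0 < pmf (\<rho> A Divide) Stop"
        by (simp_all add: divide_pos A(1))
      then show ?thesis by (simp add: s_def A(2))
    qed
    show "0 < pmf (\<Lambda> A g) (d (A, g))" if i: "(A, g) \<in> LJ \<times> {Divide}" for A g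
    proof (cases "CARD('p) = 1")
      case True
      then show ?thesis by (simp add: pmf_card_one)
    next
      case False
      have "A \<in> nodes" "g \<in> {Divide, Merge}" using i nodes(2) by auto
      then show ?thesis by (intro unif_away_01_pos[OF dir_away[OF False]]) blast
    qed
    show "X i \<in> sets borel" for i
    proof (cases i)
      case (fields A g j t)
      define c where "c = measure (F t) (rect_set (left_half j A)) / measure (F t) (rect_set A)"
      have "X i = {0<..<1} \<inter> ball c \<delta>"
        by (auto simp: X_def fields c_def dist_real_def)
      then show ?thesis by simp
    qed
    show "0 < emeasure (beta_measure (\<alpha> A g j t)) (X (A, g, j, t))"
      if i: "(A, g, j, t) \<in> LJ \<times> {Divide} \<times> UNIV \<times> {1, 2}" for A g j t
    proof -
      have A: "A \<in> nodes" and g: "g \<in> {Divide, Merge}" and t: "t \<in> {1, 2}" using i nodes(2) by auto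
      have pFt: "prob_space (F t)" "sets (F t) = sets ?C" using pF sF by (simp_all add: F_def)
      have "rect_set (left_half j A) \<subseteq> rect_set A" using rect_set_halves[OF A, of j] by blast
      then have "measure (F t) (rect_set (left_half j A)) \<le> measure (F t) (rect_set A)"
        using pFt sets_cube_borel_node[OF A]
        by (intro finite_measure.finite_measure_mono prob_space.finite_measure) simp_all
      \<comment> \<open>This also holds when \<open>F t\<close> gives \<open>A\<close> mass 0, the
        quotient then being 0; so the centre of the window lies in the unit interval, as
        \<open>beta_measure_pos\<close> requires.\<close>
      then have "measure (F t) (rect_set (left_half j A)) / measure (F t) (rect_set A) \<le> 1"
        by (intro divide_le_eq_1[THEN iffD2]) (auto simp: less_le measure_nonneg)
      then show ?thesis
        unfolding X_def prod.case using pseudo_counts[OF A g t] \<delta>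
        by (intro beta_measure_pos) auto
    qed
  qed (use nodes in auto)
  then obtain G where G: "G \<in> sets ?D" "0 < emeasure ?D G" and
    G_sub: "\<And>h S J Y. (h, S, J, Y) \<in> G \<Longrightarrow> h = h0 \<and>
      (\<forall>i\<in>insert (unit_rect, h0) (LS \<times> {Divide}). S i = s i) \<and>
      (\<forall>i\<in>LJ \<times> {Divide}. J i = d i) \<and> (\<forall>i\<in>LJ \<times> {Divide} \<times> UNIV \<times> {1, 2}. Y i \<in> X i)"
    by blast

  have good: "prob_space (dmmt_measure Q0 t \<omega>) \<and>
      (\<integral>x. \<bar>rn_dens Q0 (dmmt_measure Q0 t \<omega>) x - rn_dens Q0 (F t) x\<bar> \<partial>Q0) < \<tau>"
    if \<omega>: "\<omega> \<in> G" and t: "t \<in> {1, 2}" for \<omega> t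
  proof -
    obtain h S J Y where eq: "\<omega> = (h, S, J, Y)" by (cases \<omega>)
    have h: "h = h0" and S: "\<And>i. i \<in> insert (unit_rect, h0) (LS \<times> {Divide}) \<Longrightarrow> S i = s i"
      and J: "\<And>i. i \<in> LJ \<times> {Divide} \<Longrightarrow> J i = d i"
      and Y: "\<And>i. i \<in> LJ \<times> {Divide} \<times> UNIV \<times> {1, 2} \<Longrightarrow> Y i \<in> X i"
      using G_sub[of h S J Y] \<omega> unfolding eq by blast+
    have inLS: "A \<in> LS" if "A \<in> level_nodes k" "k \<le> K" for A k using that by (auto simp: LS_def)
    have inLJ: "A \<in> LJ" if "A \<in> level_nodes k" "k < K" for A k using that by (auto simp: LJ_def)
    have pFt: "prob_space (F t)" "sets (F t) = sets ?C" "absolutely_continuous Q0 (F t)"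
      using pF sF F1(2) F2(2) by (simp_all add: F_def)
    have root: "(unit_rect :: 'p rect) \<in> level_nodes 0" by simp
    interpret stopping_draws Q0 "F t" e K t \<delta> h0 S J Y
    proof (intro stopping_draws.intro stopping_draws_axioms.intro)
      show "dyadic_base Q0 e" by (rule base.dyadic_base_axioms)
      show "prob_space (F t)" "sets (F t) = sets ?C" "0 < \<delta>" using pFt \<delta> by auto
      show "S (A, Divide) = Divide" if "A \<in> level_nodes k" "k < K" for A k
        using S[of "(A, Divide)"] inLS[of A k] that by (simp add: s_def node_level_eq)
      show "S (A, Divide) = Stop" if "A \<in> level_nodes K" for A
        using S[of "(A, Divide)"] inLS[of A K] that by (simp add: s_def node_level_eq)
      show "S (unit_rect, h0) = S (unit_rect, Divide)"
        using S[of "(unit_rect, Divide)"] S[of "(unit_rect, h0)"] inLS[OF root] by (simp add: s_def)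
      show "J (A, Divide) = e k" if "A \<in> level_nodes k" "k < K" for A k
        using J[of "(A, Divide)"] inLJ[OF that] that by (simp add: d_def node_level_eq)
      show "Y (A, Divide, e k, t) \<in> {y. 0 < y \<and> y < 1 \<and>
          \<bar>y - measure (F t) (rect_set (left_half (e k) A)) / measure (F t) (rect_set A)\<bar> < \<delta>}"
        if "A \<in> level_nodes k" "k < K" for A k
        using Y[of "(A, Divide, e k, t)"] inLJ[OF that] t unfolding X_def by simp
    qed
    have "\<bar>base.averaged (\<lambda>A. measure (F t) (rect_set A)) K 0 unit_rect B - measure (F t) B\<bar> \<le> \<eta>"
      if "B \<in> sets Q0" for B
      using N1[OF K_ge(1) that] N2[OF K_ge(2) that] by (simp add: F_def)
    from rn_dens_dmmt_measure_L1[OF pFt(3) this] bound prob_space_dmmt_measure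
    show ?thesis unfolding eq h by auto
  qed

  define ball where "ball F = {Q \<in> space (prob_algebra ?C). absolutely_continuous Q0 Q \<and>
      (\<integral>x. \<bar>rn_dens Q0 Q x - rn_dens Q0 F x\<bar> \<partial>Q0) < \<tau>}" for F
  let ?E = "ball F1 \<times> ball F2" and ?PP = "prob_algebra ?C \<Otimes>\<^sub>M prob_algebra ?C"
  let ?f = "\<lambda>\<omega>. if prob_space (dmmt_measure Q0 1 \<omega>) \<and> prob_space (dmmt_measure Q0 2 \<omega>)
            then (dmmt_measure Q0 1 \<omega>, dmmt_measure Q0 2 \<omega>) else (Q0, Q0)"
  have f: "?f \<in> measurable ?D ?PP" by (rule measurable_dmmt_pair[OF Q0])
  have "ball F1 \<in> sets (prob_algebra ?C)" "ball F2 \<in> sets (prob_algebra ?C)"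
    unfolding ball_def by (rule measurable_L1_ball[OF Q0 F1], rule measurable_L1_ball[OF Q0 F2])
  then have E: "?E \<in> sets ?PP" by simp
  \<comment> \<open>On \<open>G\<close> both measures are probability measures, so the fallback pair
    \<open>(Q0, Q0)\<close> does not occur.\<close>
  have "G \<subseteq> ?f -` ?E \<inter> space ?D"
  proof
    fix \<omega> assume \<omega>: "\<omega> \<in> G"
    have "dmmt_measure Q0 1 \<omega> \<in> ball F1" "dmmt_measure Q0 2 \<omega> \<in> ball F2"
      using good[OF \<omega>, of 1] good[OF \<omega>, of 2] base.absolutely_continuous_dmmt_measure
      by (simp_all add: ball_def space_prob_algebra sets_dmmt_measure F_def)
    then show "\<omega> \<in> ?f -` ?E \<inter> space ?D"
      using good[OF \<omega>, of 1] good[OF \<omega>, of 2] sets.sets_into_space[OF G(1)] \<omega> by auto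
  qed
  then have "emeasure ?D G \<le> emeasure ?D (?f -` ?E \<inter> space ?D)"
    by (rule emeasure_mono) (rule measurable_sets[OF f E])
  also have "\<dots> = emeasure (DMMT \<rho>0 \<rho> \<alpha> \<Lambda> Q0) ?E"
    unfolding DMMT_def by (rule emeasure_distr[OF f E, symmetric])
  also have "\<dots> = emeasure M ((\<lambda>\<omega>. (Q1 \<omega>, Q2 \<omega>)) -` ?E \<inter> space M)"
    unfolding Q_law[symmetric] by (rule emeasure_distr[OF Q_rv E])
  also have "(\<lambda>\<omega>. (Q1 \<omega>, Q2 \<omega>)) -` ?E \<inter> space M = {\<omega> \<in> space M.
           absolutely_continuous Q0 (Q1 \<omega>) \<and> absolutely_continuous Q0 (Q2 \<omega>) \<and>
           (\<integral>x. \<bar>rn_dens Q0 (Q1 \<omega>) x - rn_dens Q0 F1 x\<bar> \<partial>Q0) < \<tau> \<and>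
           (\<integral>x. \<bar>rn_dens Q0 (Q2 \<omega>) x - rn_dens Q0 F2 x\<bar> \<partial>Q0) < \<tau>}"
    using measurable_space[OF Q_rv] by (auto simp: ball_def space_pair_measure)
  finally show ?thesis
    using order.strict_trans2[OF G(2)] unfolding M.emeasure_eq_measure
    by (metis (no_types, lifting) ennreal_less_zero_iff)
qed

end
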